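(* Let $\lambda$ and $\mu$ be partitions with $\mu$ contained in $\lambda$, and let $a$ be an integer such that $a+c(\rho)>0$ for all cells $\rho\in\lambda/\mu$. Let $\Phi$ and $\Psi$ be the two algorithms (based on modified jeu de taquin slides) described in the context. Then $\Phi$ is a well-defined map from the set of reverse semistandard Young tableaux $Q$ of shape $\lambda/\mu$ to the set of pairs $(R,T)$, where $R$ is a reverse semistandard Young tableau of shape $\lambda/\mu$ with $R_{(i,j)}\le a+\mu_i-i$ for all cells $(i,j)\in\lambda/\mu$ and $T$ is an arbitrary tabloid of shape $\lambda/\mu$; $\Psi$ is a well-defined map in the opposite direction; $\Phi$ and $\Psi$ are inverse to each other; and whenever $Q$ corresponds to $(R,T)$ one has $$n(Q)=n(R)+w_c(T).$$
   Context: **Basic notions.** A partition is a sequence $\lambda=(\lambda_1,\dots,\lambda_r)$ with $\lambda_1\ge\dots\ge\lambda_r>0$. Its Ferrers diagram has $r$ left-justified rows with $\lambda_i$ cells in row $i$ (row 1 on top); the cell in row $i$ and column $j$ is $(i,j)$. A partition $\mu=(\mu_1,\dots,\mu_s)$ is contained in $\lambda$ if $s\le r$ and $\mu_i\le\lambda_i$ for $1\le i\le s$; put $\mu_i=0$ for $i>s$. The skew diagram $\lambda/\mu$ consists of the cells of $\lambda$ that are not cells of $\mu$. The content of a cell $\rho=(i,j)$ is $c(\rho)=j-i$. A tabloid of shape $\lambda/\mu$ is a filling $T$ of the cells of $\lambda/\mu$ with non-negative integers; $T_\rho$ is the entry in cell $\rho$. The norm $n(T)$ is the sum of all entries of $T$,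 and the content weight is $w_c(T)=\sum_{\rho\in\lambda/\mu}T_\rho\,(a+c(\rho))$. A reverse semistandard Young tableau (reverse SSYT) of shape $\lambda/\mu$ is a tabloid whose entries are weakly decreasing along rows (left to right) and strictly decreasing along columns (top to bottom). In the algorithms below, a comparison that involves the entry of a cell not belonging to $\lambda/\mu$ is regarded as false. **Algorithm $\Phi$** (input: a reverse SSYT $Q$ of shape $\lambda/\mu$; output: $(R,T)$). Set $R=Q$ and set all entries of $T$ equal to $0$. While there is a cell $\tau=(i,j)$ of $\lambda/\mu$ with $R_\tau>a+\mu_i-i$, do the following. 1. Let $e$ be the maximum of $R_\tau-(a+c(\tau))$ over all cells $\tau$. Among all cells $\tau$ with $R_\tau-(a+c(\tau))=e$, let $\rho=(i,j)$ be the bottommost one. Set $R_\rho=e$. 2. While $e<R_{(i,j+1)}$ or $e\le R_{(i+1,j)}$, where $\rho=(i,j)$ is the current cell: let $x$ be the entry of $R$ to the right of $\rho$ (in $(i,j+1)$) and $y$ the entry below $\rho$ (in $(i+1,j)$), where one of these two cells may be missing. - If $x-1>y$, or there is no cell below $\rho$: put $x-1$ into cell $(i,j)$ and $e$ into cell $(i,j+1)$, and let $\rho$ become $(i,j+1)$. - Otherwise ($y+1\ge x$, or there is no cell to the right): put $y+1$ into cell $(i,j)$ and $e$ into cell $(i+1,j)$, and let $\rho$ become $(i+1,j)$. 3. Increase $T_\rho$ by one. The output is the final pair $(R,T)$. **Algorithm $\Psi$** (input: a pair $(R,T)$ with $R$ a reverse SSYT of shape $\lambda/\mu$ satisfying $R_{(i,j)}\le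 a+\mu_i-i$ for all cells and $T$ a tabloid of shape $\lambda/\mu$; output: $Q$). Set $Q=R$. While there is a cell $\tau$ with $T_\tau\ne0$, do the following. 1. Let $e$ be minimal such that there is a cell $\tau$ with $Q_\tau=e$ and $T_\tau\ne0$. Among these cells $\tau$ let $\rho=(i,j)$ be the rightmost one. Decrease $T_\rho$ by one. 2. While $e+a+c(\rho)>Q_{(i,j-1)}$ or $e+a+c(\rho)\ge Q_{(i-1,j)}$, where $\rho=(i,j)$ is the current cell: let $x$ be the entry of $Q$ to the left of $\rho$ (in $(i,j-1)$) and $y$ the entry above $\rho$ (in $(i-1,j)$), where one of these two cells may be missing. - If $y>x+1$, or there is no cell above $\rho$: put $x+1$ into cell $(i,j)$ and $e$ into cell $(i,j-1)$, and let $\rho$ become $(i,j-1)$. - Otherwise ($x\ge y-1$, or there is no cell to the left): put $y-1$ into cell $(i,j)$ and $e$ into cell $(i-1,j)$, and let $\rho$ become $(i-1,j)$. 3. Increase $Q_\rho$ by $a+c(\rho)$. The output is the final $Q$. *)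

theory Defs
  imports "HOL-Library.While_Combinator" "HOL-Library.Monad_Syntax"
begin

definition is_partition :: "nat list \<Rightarrow> bool" where
  "is_partition lam \<longleftrightarrow> sorted_wrt (\<ge>) lam \<and> (\<forall>p\<in>set lam. p > 0)"

text \<open>Parts are numbered from 1, and are 0 beyond the last one.\<close>

definition part :: "nat list \<Rightarrow> nat \<Rightarrow> nat" where
  "part lam i = (if 1 \<le> i \<and> i \<le> length lam then lam ! (i - 1) else 0)"

definition partition_contained :: "nat list \<Rightarrow> nat list \<Rightarrow> bool" where
  "partition_contained mu lam \<longleftrightarrow>
     length mu \<le> length lam \<and> (\<forall>i. 1 \<le> i \<and> i \<le> length mu \<longrightarrow> part mu i \<le> part lam i)"

text \<open>Cells are pairs (row, column), both numbered from 1. Hence a predecessor \<open>i - 1\<close> or \<open>j - 1\<close>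
  of a coordinate of a cell is never truncated, and the value 0 means that there is no such cell.\<close>

type_synonym cell = "nat \<times> nat"

definition diagram :: "nat list \<Rightarrow> cell set" where
  "diagram lam = {(i, j). 1 \<le> i \<and> i \<le> length lam \<and> 1 \<le> j \<and> j \<le> part lam i}"

definition skew :: "nat list \<Rightarrow> nat list \<Rightarrow> cell set" where
  "skew lam mu = diagram lam - diagram mu"

definition content :: "cell \<Rightarrow> int" where
  "content \<rho> = int (snd \<rho>) - int (fst \<rho>)"

text \<open>A filling of the cells of a set \<open>D\<close> is represented by a function on all cells that vanishes
  outside \<open>D\<close>, so that equality of functions is equality of fillings. The algorithms never use an
  entry outside the shape without checking membership, and never write one.\<close>

type_synonym filling = "cell \<Rightarrow> int"

definition tabloids :: "cell set \<Rightarrow> filling set" where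
  "tabloids D = {T. (\<forall>\<rho>\<in>D. T \<rho> \<ge> 0) \<and> (\<forall>\<rho>. \<rho> \<notin> D \<longrightarrow> T \<rho> = 0)}"

definition norm_of :: "cell set \<Rightarrow> filling \<Rightarrow> int" where
  "norm_of D T = (\<Sum>\<rho>\<in>D. T \<rho>)"

definition content_weight :: "int \<Rightarrow> cell set \<Rightarrow> filling \<Rightarrow> int" where
  "content_weight a D T = (\<Sum>\<rho>\<in>D. T \<rho> * (a + content \<rho>))"

definition reverse_ssyts :: "cell set \<Rightarrow> filling set" where
  "reverse_ssyts D = {T \<in> tabloids D.
     (\<forall>i j j'. (i, j) \<in> D \<and> (i, j') \<in> D \<and> j < j' \<longrightarrow> T (i, j) \<ge> T (i, j')) \<and>
     (\<forall>i i' j. (i, j) \<in> D \<and> (i', j) \<in> D \<and> i < i' \<longrightarrow> T (i, j) > T (i', j))}"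

definition bounded_reverse_ssyts :: "int \<Rightarrow> nat list \<Rightarrow> nat list \<Rightarrow> filling set" where
  "bounded_reverse_ssyts a lam mu = {R \<in> reverse_ssyts (skew lam mu).
     \<forall>(i, j)\<in>skew lam mu. R (i, j) \<le> a + int (part mu i) - int i}"

text \<open>Both algorithms are partial: the value \<open>None\<close> means that the run does not terminate, or that it
  reaches a selection step (``the bottommost one'', ``the rightmost one'') for which there is not
  exactly one candidate.\<close>

definition the_only :: "('b \<Rightarrow> bool) \<Rightarrow> 'b option" where
  "the_only P = (if \<exists>!x. P x then Some (THE x. P x) else None)"

subsection \<open>Algorithm \<open>\<Phi>\<close>\<close>

definition phi_max :: "int \<Rightarrow> cell set \<Rightarrow> filling \<Rightarrow> int" where
  "phi_max a D R = Max ((\<lambda>\<tau>. R \<tau> - (a + content \<tau>)) ` D)"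

definition phi_select :: "int \<Rightarrow> cell set \<Rightarrow> filling \<Rightarrow> int \<Rightarrow> cell option" where
  "phi_select a D R e = the_only (\<lambda>\<rho>. \<rho> \<in> D \<and> R \<rho> - (a + content \<rho>) = e \<and>
     (\<forall>\<tau>\<in>D. R \<tau> - (a + content \<tau>) = e \<longrightarrow> fst \<tau> \<le> fst \<rho>))"

definition phi_slide_cond :: "cell set \<Rightarrow> int \<Rightarrow> filling \<times> cell \<Rightarrow> bool" where
  "phi_slide_cond D e = (\<lambda>(R, (i, j)).
     ((i, j + 1) \<in> D \<and> e < R (i, j + 1)) \<or> ((i + 1, j) \<in> D \<and> e \<le> R (i + 1, j)))"

definition phi_slide_step :: "cell set \<Rightarrow> int \<Rightarrow> filling \<times> cell \<Rightarrow> filling \<times> cell" where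
  "phi_slide_step D e = (\<lambda>(R, (i, j)).
     let x = R (i, j + 1); y = R (i + 1, j) in
     if ((i, j + 1) \<in> D \<and> (i + 1, j) \<in> D \<and> x - 1 > y) \<or> (i + 1, j) \<notin> D
     then (R((i, j) := x - 1, (i, j + 1) := e), (i, j + 1))
     else (R((i, j) := y + 1, (i + 1, j) := e), (i + 1, j)))"

definition phi_slide :: "cell set \<Rightarrow> int \<Rightarrow> filling \<Rightarrow> cell \<Rightarrow> (filling \<times> cell) option" where
  "phi_slide D e R \<rho> = while_option (phi_slide_cond D e) (phi_slide_step D e) (R(\<rho> := e), \<rho>)"

partial_function (option) phi_loop ::
  "int \<Rightarrow> nat list \<Rightarrow> nat list \<Rightarrow> filling \<Rightarrow> filling \<Rightarrow> (filling \<times> filling) option" where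
  "phi_loop a lam mu R T =
     (if \<exists>(i, j)\<in>skew lam mu. R (i, j) > a + int (part mu i) - int i
      then let e = phi_max a (skew lam mu) R in
        do {
          \<rho> \<leftarrow> phi_select a (skew lam mu) R e;
          (R', \<rho>') \<leftarrow> phi_slide (skew lam mu) e R \<rho>;
          phi_loop a lam mu R' (T(\<rho>' := T \<rho>' + 1))
        }
      else Some (R, T))"

definition Phi :: "int \<Rightarrow> nat list \<Rightarrow> nat list \<Rightarrow> filling \<Rightarrow> (filling \<times> filling) option" where
  "Phi a lam mu Q = phi_loop a lam mu Q (\<lambda>_. 0)"

subsection \<open>Algorithm \<open>\<Psi>\<close>\<close>

definition psi_min :: "cell set \<Rightarrow> filling \<Rightarrow> filling \<Rightarrow> int" where
  "psi_min D Q T = Min (Q ` {\<tau> \<in> D. T \<tau> \<noteq> 0})"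

definition psi_select :: "cell set \<Rightarrow> filling \<Rightarrow> filling \<Rightarrow> int \<Rightarrow> cell option" where
  "psi_select D Q T e = the_only (\<lambda>\<rho>. \<rho> \<in> D \<and> Q \<rho> = e \<and> T \<rho> \<noteq> 0 \<and>
     (\<forall>\<tau>\<in>D. Q \<tau> = e \<and> T \<tau> \<noteq> 0 \<longrightarrow> snd \<tau> \<le> snd \<rho>))"

definition psi_slide_cond :: "int \<Rightarrow> cell set \<Rightarrow> int \<Rightarrow> filling \<times> cell \<Rightarrow> bool" where
  "psi_slide_cond a D e = (\<lambda>(Q, (i, j)).
     ((i, j - 1) \<in> D \<and> e + a + content (i, j) > Q (i, j - 1)) \<or>
     ((i - 1, j) \<in> D \<and> e + a + content (i, j) \<ge> Q (i - 1, j)))"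

definition psi_slide_step :: "cell set \<Rightarrow> int \<Rightarrow> filling \<times> cell \<Rightarrow> filling \<times> cell" where
  "psi_slide_step D e = (\<lambda>(Q, (i, j)).
     let x = Q (i, j - 1); y = Q (i - 1, j) in
     if ((i, j - 1) \<in> D \<and> (i - 1, j) \<in> D \<and> y > x + 1) \<or> (i - 1, j) \<notin> D
     then (Q((i, j) := x + 1, (i, j - 1) := e), (i, j - 1))
     else (Q((i, j) := y - 1, (i - 1, j) := e), (i - 1, j)))"

definition psi_slide ::
  "int \<Rightarrow> cell set \<Rightarrow> int \<Rightarrow> filling \<Rightarrow> cell \<Rightarrow> (filling \<times> cell) option" where
  "psi_slide a D e Q \<rho> = while_option (psi_slide_cond a D e) (psi_slide_step D e) (Q, \<rho>)"

partial_function (option) psi_loop ::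
  "int \<Rightarrow> nat list \<Rightarrow> nat list \<Rightarrow> filling \<Rightarrow> filling \<Rightarrow> filling option" where
  "psi_loop a lam mu Q T =
     (if \<exists>\<tau>\<in>skew lam mu. T \<tau> \<noteq> 0
      then let e = psi_min (skew lam mu) Q T in
        do {
          \<rho> \<leftarrow> psi_select (skew lam mu) Q T e;
          (Q', \<rho>') \<leftarrow> psi_slide a (skew lam mu) e Q \<rho>;
          psi_loop a lam mu (Q'(\<rho>' := Q' \<rho>' + (a + content \<rho>'))) (T(\<rho> := T \<rho> - 1))
        }
      else Some Q)"

definition Psi :: "int \<Rightarrow> nat list \<Rightarrow> nat list \<Rightarrow> filling \<times> filling \<Rightarrow> filling option" where
  "Psi a lam mu = (\<lambda>(R, T). psi_loop a lam mu R T)"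

end

theory Submission
  imports Defs
begin

text \<open>
  Write \<open>s = R - (a + c)\<close> for the excess of a filling over the cell weights. It strictly decreases along
  rows and weakly along columns, and both kinds of slide are ordinary jeu de taquin in \<open>s\<close>: every moved
  entry keeps its excess. A \<open>\<Phi>\<close>-round takes out an entry of maximal excess \<open>e\<close>, lets the hole travel
  right and down, and stops as soon as the plain value \<open>e\<close> fits; a \<open>\<Psi>\<close>-round takes out a plain value
  \<open>e\<close>, lets the hole travel left and up, and stops as soon as the excess \<open>e\<close> fits. The two rounds undo
  each other provided that they select each other's end cells.

  That is guaranteed by one invariant of pairs \<open>(R, T)\<close>: no excess is greater than the entry of a marked
  cell (one with \<open>T \<noteq> 0\<close>), and whenever the excess at \<open>p\<close> equals the entry of a marked cell \<open>q\<close>, a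
  staircase of inequalities between neighbours on antidiagonals separates \<open>p\<close> from \<open>q\<close>. A slide leaves
  such a staircase behind, and a later slide with the same \<open>e\<close> cannot cross it. The invariant is preserved
  by both rounds, and it holds trivially if \<open>T = 0\<close> or if all excesses are negative, that is, at the
  start of either algorithm.
\<close>

section \<open>Running a loop backwards; finite maxima and unique choice\<close>

text \<open>The forward loop carries the invariant that the backward loop, started in the current
  state, ends in \<open>s\<close>. Since \<open>b'\<close> holds after every forward step, the
  backward loop takes one more step there and falls back on the previous state;
  \<open>\<not> b' s\<close> makes it halt exactly at \<open>s\<close>.\<close>

lemma while_option_reverse:
  assumes run: "while_option b c s = Some t"
    and inv: "P s"
    and step: "\<And>s. P s \<Longrightarrow> b s \<Longrightarrow> P (c s) \<and> b' (c s) \<and> c' (c s) = s"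
    and "\<not> b' s"
  shows "while_option b' c' t = Some s"
proof -
  have "P t \<and> while_option b' c' t = Some s"
  proof (rule while_option_rule[OF _ run, where P = "\<lambda>u. P u \<and> while_option b' c' u = Some s"])
    show "P s \<and> while_option b' c' s = Some s"
      using inv assms(4) by (simp add: while_option_unfold)
    show "P (c u) \<and> while_option b' c' (c u) = Some s"
      if "P u \<and> while_option b' c' u = Some s" "b u" for u
      using that step[of u] while_option_unfold[of b' c' "c u"] by simp
  qed
  then show ?thesis ..
qed

lemma finite_ex_maximal:
  fixes f :: "'b \<Rightarrow> nat"
  assumes "finite E" "E \<noteq> {}"
  shows "\<exists>p\<in>E. \<forall>q\<in>E. f q \<le> f p"
proof -
  have "Max (f ` E) \<in> f ` E" using assms by simp
  then obtain p where "p \<in> E" "Max (f ` E) = f p" by auto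
  then show ?thesis using Max_ge[of "f ` E"] assms(1) by (metis finite_imageI imageI)
qed

lemma the_onlyI: "P x \<Longrightarrow> (\<And>y. P y \<Longrightarrow> y = x) \<Longrightarrow> the_only P = Some x"
  unfolding the_only_def using the_equality[of P x] ex1I[of P x] by metis

section \<open>Fillings of convex shapes and their excess\<close>

text \<open>The analysis of single rounds sees a skew diagram only through these properties.
  Convexity keeps every cell between two cells in the shape, and positive indices make the truncated
  subtractions of the algorithms harmless.\<close>

locale skew_shape =
  fixes D :: "cell set" and a :: int
  assumes finite: "finite D"
    and convex: "\<lbrakk>(i, j) \<in> D; (i', j') \<in> D; i \<le> k; k \<le> i'; j \<le> l; l \<le> j'\<rbrakk> \<Longrightarrow> (k, l) \<in> D"
    and index_pos: "(i, j) \<in> D \<Longrightarrow> 0 < i \<and> 0 < j"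
    and weight_pos: "\<rho> \<in> D \<Longrightarrow> a + content \<rho> > 0"
begin

definition excess :: "filling \<Rightarrow> cell \<Rightarrow> int" where
  "excess R \<rho> = R \<rho> - (a + content \<rho>)"

lemma excess_pair: "excess R (i, j) = R (i, j) - a - int j + int i"
  by (simp add: excess_def content_def)

text \<open>The cell \<open>h\<close> is the hole of a slide. All comparable pairs are covered, not
  only neighbours, so that cells on opposite sides of the hole stay comparable. A larger column
  guarantees a gap of 1 only, whatever the distance: after a move to the right, the two row
  neighbours of the hole may differ by no more.\<close>

definition ordered_off :: "cell \<Rightarrow> filling \<Rightarrow> bool" where
  "ordered_off h R \<longleftrightarrow> (\<forall>i j i' j'. (i, j) \<in> D - {h} \<longrightarrow> (i', j') \<in> D - {h} \<longrightarrow> i \<le> i' \<longrightarrow> j \<le> j' \<longrightarrow>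
     excess R (i', j') + (if j < j' then 1 else 0) \<le> excess R (i, j))"

lemma ordered_offD:
  "\<lbrakk>ordered_off h R; (i, j) \<in> D; (i', j') \<in> D; (i, j) \<noteq> h; (i', j') \<noteq> h; i \<le> i'; j \<le> j'\<rbrakk> \<Longrightarrow>
     excess R (i', j') + (if j < j' then 1 else 0) \<le> excess R (i, j)"
  unfolding ordered_off_def by blast

text \<open>Go along row \<open>i\<close> to column \<open>j'\<close>, then down that column, where
  every step costs at least 1; convexity keeps the path inside \<open>D\<close>.\<close>

lemma rssyt_leD:
  assumes "R \<in> reverse_ssyts D" "(i, j) \<in> D" "(i', j') \<in> D" "i \<le> i'" "j \<le> j'"
  shows "R (i', j') + int i' \<le> R (i, j) + int i"
proof -
  have row: "R (i, j') \<le> R (i, j)"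
    using assms convex[OF assms(2,3), of i j'] unfolding reverse_ssyts_def
    by (cases "j = j'") auto
  have "(k, j') \<in> D \<Longrightarrow> R (k, j') + int k \<le> R (i, j') + int i" if "i \<le> k" for k
    using that
  proof (induction k rule: dec_induct)
    case (step k)
    have "(k, j') \<in> D"
      using convex[OF assms(2) step.prems, of k j'] step.hyps assms(5) by simp
    then have "R (Suc k, j') < R (k, j')"
      using assms(1) step.prems unfolding reverse_ssyts_def by auto
    then show ?case using step.IH[OF \<open>(k, j') \<in> D\<close>] by simp
  qed simp
  from this[OF assms(4) assms(3)] row show ?thesis by simp
qed

lemma rssyt_excess:
  assumes "R \<in> reverse_ssyts D" "(i, j) \<in> D" "(i', j') \<in> D" "i \<le> i'" "j \<le> j'"
  shows "excess R (i', j') + (int j' - int j) \<le> excess R (i, j)"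
  using rssyt_leD[OF assms] by (simp add: excess_pair)

lemma rssyt_ordered_off:
  assumes "R \<in> reverse_ssyts D"
  shows "ordered_off h (R(h := e))"
  unfolding ordered_off_def
proof (intro allI impI)
  fix i j i' j'
  assume "(i, j) \<in> D - {h}" "(i', j') \<in> D - {h}" "i \<le> i'" "j \<le> j'"
  then show "excess (R(h := e)) (i', j') + (if j < j' then 1 else 0) \<le> excess (R(h := e)) (i, j)"
    using rssyt_excess[OF assms, of i j i' j'] by (auto simp: excess_def)
qed

lemma rssyt_adjacentI:
  assumes "R \<in> tabloids D"
    and row: "\<And>i j. (i, j) \<in> D \<Longrightarrow> (i, Suc j) \<in> D \<Longrightarrow> R (i, Suc j) \<le> R (i, j)"
    and col: "\<And>i j. (i, j) \<in> D \<Longrightarrow> (Suc i, j) \<in> D \<Longrightarrow> R (Suc i, j) < R (i, j)"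
  shows "R \<in> reverse_ssyts D"
proof -
  have "(i, j') \<in> D \<Longrightarrow> R (i, j') \<le> R (i, j)" if "j \<le> j'" "(i, j) \<in> D" for i j j'
    using that(1)
  proof (induction j' rule: dec_induct)
    case (step n)
    have n: "(i, n) \<in> D" using convex[OF that(2) step.prems, of i n] step.hyps by simp
    show ?case using step.IH[OF n] row[OF n step.prems] by linarith
  qed simp
  moreover have "(i', j) \<in> D \<Longrightarrow> R (i', j) + int i' \<le> R (i, j) + int i" if "i \<le> i'" "(i, j) \<in> D" for i i' j
    using that(1)
  proof (induction i' rule: dec_induct)
    case (step n)
    have n: "(n, j) \<in> D" using convex[OF that(2) step.prems, of n j] step.hyps by simp
    show ?case using step.IH[OF n] col[OF n step.prems] by simp
  qed simp
  ultimately show ?thesis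
    using assms(1) unfolding reverse_ssyts_def by (simp, smt (verit, best) less_imp_le of_nat_less_iff)
qed

text \<open>Off the hole, the order of the excesses already yields the tableau inequalities between
  neighbours, so four comparisons at the hole remain. \<open>R\<close> may differ from the slid
  filling \<open>R'\<close> in the hole, because \<open>\<Psi>\<close> finally raises that entry by
  the weight of the cell.\<close>

lemma rssyt_fill_hole:
  assumes "R \<in> tabloids D" "ordered_off (i, j) R'"
    and off: "\<And>p. p \<in> D \<Longrightarrow> p \<noteq> (i, j) \<Longrightarrow> R p = R' p"
    and "\<And>l. (i, l) \<in> D \<Longrightarrow> Suc l = j \<Longrightarrow> R (i, j) \<le> R (i, l)"
    and "\<And>k. (k, j) \<in> D \<Longrightarrow> Suc k = i \<Longrightarrow> R (i, j) < R (k, j)"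
    and "(i, Suc j) \<in> D \<Longrightarrow> R (i, Suc j) \<le> R (i, j)"
    and "(Suc i, j) \<in> D \<Longrightarrow> R (Suc i, j) < R (i, j)"
  shows "R \<in> reverse_ssyts D"
proof (rule rssyt_adjacentI)
  fix k l assume D: "(k, l) \<in> D" "(k, Suc l) \<in> D"
  show "R (k, Suc l) \<le> R (k, l)"
  proof (cases "(k, l) = (i, j) \<or> (k, Suc l) = (i, j)")
    case True
    then show ?thesis using assms D by auto
  next
    case False
    then show ?thesis using ordered_offD[OF assms(2) D] off D by (simp add: excess_pair)
  qed
next
  fix k l assume D: "(k, l) \<in> D" "(Suc k, l) \<in> D"
  show "R (Suc k, l) < R (k, l)"
  proof (cases "(k, l) = (i, j) \<or> (Suc k, l) = (i, j)")
    case True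
    then show ?thesis using assms D by auto
  next
    case False
    then show ?thesis using ordered_offD[OF assms(2) D] off D by (simp add: excess_pair)
  qed
qed fact

section \<open>Single moves of the hole preserve the order of the excesses\<close>

text \<open>The moved entry keeps its excess, and \<open>d\<close> says that the entry below has no
  greater one; a tie may go right because excesses may repeat down a column but not along a row.
  Only pairs with the refilled cell \<open>(i, j)\<close> are new. Those towards lower rows are
  compared through \<open>(Suc i, j)\<close>, which convexity puts into \<open>D\<close>.\<close>

lemma ordered_off_right:
  assumes ord: "ordered_off (i, j) R" and h: "(i, j) \<in> D" and r: "(i, Suc j) \<in> D"
    and d: "(Suc i, j) \<in> D \<Longrightarrow> R (Suc i, j) + 1 < R (i, Suc j)"
  shows "ordered_off (i, Suc j) (R((i, j) := R (i, Suc j) - 1, (i, Suc j) := e))" (is "ordered_off ?h ?R")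
proof -
  have new: "excess ?R (i, j) = excess R (i, Suc j)" by (simp add: excess_pair)
  have old: "excess ?R p = excess R p" if "p \<noteq> (i, j)" "p \<noteq> ?h" for p
    using that by (simp add: excess_def)
  have d': "excess R (Suc i, j) \<le> excess R (i, Suc j)" if "(Suc i, j) \<in> D"
    using d[OF that] by (simp add: excess_pair)
  show ?thesis
    unfolding ordered_off_def
  proof (intro allI impI)
    fix k l k' l'
    assume D: "(k, l) \<in> D - {?h}" "(k', l') \<in> D - {?h}" and le: "k \<le> k'" "l \<le> l'"
    show "excess ?R (k', l') + (if l < l' then 1 else 0) \<le> excess ?R (k, l)"
    proof (cases "(k, l) = (i, j)")
      case False
      note kl = False
      show ?thesis
      proof (cases "(k', l') = (i, j)")
        case True
        then show ?thesis
          using ordered_offD[OF ord, of k l i "Suc j"] D kl le r new old[of "(k, l)"]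
          by (auto split: if_splits)
      next
        case False
        then show ?thesis
          using ordered_offD[OF ord, of k l k' l'] D kl le old by simp
      qed
    next
      case True
      note kl = True
      show ?thesis
      proof (cases "(k', l') = (i, j)")
        case False
        note kl' = False
        have o: "excess ?R (k', l') = excess R (k', l')" using old[of "(k', l')"] D False by simp
        show ?thesis
        proof (cases "k' = i")
          case True
          then have "Suc j < l'" using D False kl le by auto
          then show ?thesis
            using ordered_offD[OF ord r, of k' l'] True D le kl kl' new o by (simp split: if_splits)
        next
          case False
          then have k': "Suc i \<le> k'" using le kl by simp
          then have sD: "(Suc i, j) \<in> D"
            using convex[OF h, of k' l' "Suc i" j] D le kl by simp
          then show ?thesis
            using ordered_offD[OF ord sD, of k' l'] k' D le kl kl' new o d' by (auto split: if_splits)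
        qed
      qed (use kl in simp)
    qed
  qed
qed

text \<open>Here \<open>r\<close> says that the right neighbour has strictly smaller excess than the
  entry coming up, which is the strictness that row \<open>i\<close> demands.\<close>

lemma ordered_off_down:
  assumes ord: "ordered_off (i, j) R" and h: "(i, j) \<in> D" and d: "(Suc i, j) \<in> D"
    and r: "(i, Suc j) \<in> D \<Longrightarrow> R (i, Suc j) - 1 \<le> R (Suc i, j)"
  shows "ordered_off (Suc i, j) (R((i, j) := R (Suc i, j) + 1, (Suc i, j) := e))" (is "ordered_off ?h ?R")
proof -
  have new: "excess ?R (i, j) = excess R (Suc i, j)" by (simp add: excess_pair)
  have old: "excess ?R p = excess R p" if "p \<noteq> (i, j)" "p \<noteq> ?h" for p
    using that by (simp add: excess_def)
  have r': "excess R (i, Suc j) < excess R (Suc i, j)" if "(i, Suc j) \<in> D"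
    using r[OF that] by (simp add: excess_pair)
  show ?thesis
    unfolding ordered_off_def
  proof (intro allI impI)
    fix k l k' l'
    assume D: "(k, l) \<in> D - {?h}" "(k', l') \<in> D - {?h}" and le: "k \<le> k'" "l \<le> l'"
    show "excess ?R (k', l') + (if l < l' then 1 else 0) \<le> excess ?R (k, l)"
    proof (cases "(k, l) = (i, j)")
      case False
      note kl = False
      show ?thesis
      proof (cases "(k', l') = (i, j)")
        case True
        then show ?thesis
          using ordered_offD[OF ord, of k l "Suc i" j] D kl le d new old[of "(k, l)"]
          by (auto split: if_splits)
      next
        case False
        then show ?thesis
          using ordered_offD[OF ord, of k l k' l'] D kl le old by simp
      qed
    next
      case True
      note kl = True
      show ?thesis
      proof (cases "(k', l') = (i, j)")
        case False
        note kl' = False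
        have o: "excess ?R (k', l') = excess R (k', l')" using old[of "(k', l')"] D False by simp
        show ?thesis
        proof (cases "k' = i")
          case True
          then have l': "Suc j \<le> l'" using D False kl le by auto
          then have sD: "(i, Suc j) \<in> D"
            using convex[OF h, of k' l' i "Suc j"] D le kl True by simp
          then show ?thesis
            using ordered_offD[OF ord sD, of k' l'] l' True D le kl kl' new o r' by (auto split: if_splits)
        next
          case False
          then have k': "Suc i \<le> k'" using le kl by simp
          then show ?thesis
            using ordered_offD[OF ord d, of k' l'] k' D le kl kl' new o by (auto split: if_splits)
        qed
      qed (use kl in simp)
    qed
  qed
qed

text \<open>In this direction the entry of smaller excess moves into the hole, and a tie goes left.
  The upper neighbour is given by \<open>i = Suc k\<close>, which avoids truncated subtraction in
  the first row.\<close>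

lemma ordered_off_left:
  assumes ord: "ordered_off (i, Suc j) R" and h: "(i, Suc j) \<in> D" and l: "(i, j) \<in> D"
    and u: "\<And>k. (k, Suc j) \<in> D \<Longrightarrow> i = Suc k \<Longrightarrow> R (i, j) + 1 < R (k, Suc j)"
  shows "ordered_off (i, j) (R((i, Suc j) := R (i, j) + 1, (i, j) := e))" (is "ordered_off ?h ?R")
proof -
  have new: "excess ?R (i, Suc j) = excess R (i, j)" by (simp add: excess_pair)
  have old: "excess ?R p = excess R p" if "p \<noteq> (i, Suc j)" "p \<noteq> ?h" for p
    using that by (simp add: excess_def)
  have u': "excess R (i, j) \<le> excess R (k, Suc j)" if "(k, Suc j) \<in> D" "i = Suc k" for k
    using u[OF that] that by (simp add: excess_pair)
  show ?thesis
    unfolding ordered_off_def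
  proof (intro allI impI)
    fix k l k' l'
    assume D: "(k, l) \<in> D - {?h}" "(k', l') \<in> D - {?h}" and le: "k \<le> k'" "l \<le> l'"
    show "excess ?R (k', l') + (if l < l' then 1 else 0) \<le> excess ?R (k, l)"
    proof (cases "(k', l') = (i, Suc j)")
      case False
      note kl' = False
      show ?thesis
      proof (cases "(k, l) = (i, Suc j)")
        case True
        then show ?thesis
          using ordered_offD[OF ord, of i j k' l'] D kl' le assms(3) new old[of "(k', l')"]
          by (auto split: if_splits)
      next
        case False
        then show ?thesis
          using ordered_offD[OF ord, of k l k' l'] D kl' le old by simp
      qed
    next
      case True
      note kl' = True
      show ?thesis
      proof (cases "(k, l) = (i, Suc j)")
        case False
        note kl = False
        have o: "excess ?R (k, l) = excess R (k, l)" using old[of "(k, l)"] D False by simp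
        show ?thesis
        proof (cases "k = i")
          case True
          then have "l < j" using D False kl' le by auto
          then show ?thesis
            using ordered_offD[OF ord, of k l i j] assms(3) True D le kl kl' new o by (simp split: if_splits)
        next
          case False
          then obtain m where m: "i = Suc m" "k \<le> m" using le kl' by (cases i) auto
          then have sD: "(m, Suc j) \<in> D"
            using convex[of k l i "Suc j" m "Suc j"] D le kl' h by simp
          then show ?thesis
            using ordered_offD[OF ord, of k l m "Suc j"] m D le kl kl' new o u'[OF sD]
            by (auto split: if_splits)
        qed
      qed (use kl' in simp)
    qed
  qed
qed

lemma ordered_off_up:
  assumes ord: "ordered_off (Suc i, j) R" and h: "(Suc i, j) \<in> D" and u: "(i, j) \<in> D"
    and l: "\<And>k. (Suc i, k) \<in> D \<Longrightarrow> j = Suc k \<Longrightarrow> R (i, j) \<le> R (Suc i, k) + 1"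
  shows "ordered_off (i, j) (R((Suc i, j) := R (i, j) - 1, (i, j) := e))" (is "ordered_off ?h ?R")
proof -
  have new: "excess ?R (Suc i, j) = excess R (i, j)" by (simp add: excess_pair)
  have old: "excess ?R p = excess R p" if "p \<noteq> (Suc i, j)" "p \<noteq> ?h" for p
    using that by (simp add: excess_def)
  have l': "excess R (i, j) < excess R (Suc i, k)" if "(Suc i, k) \<in> D" "j = Suc k" for k
    using l[OF that] that by (simp add: excess_pair)
  show ?thesis
    unfolding ordered_off_def
  proof (intro allI impI)
    fix k l k' l'
    assume D: "(k, l) \<in> D - {?h}" "(k', l') \<in> D - {?h}" and le: "k \<le> k'" "l \<le> l'"
    show "excess ?R (k', l') + (if l < l' then 1 else 0) \<le> excess ?R (k, l)"
    proof (cases "(k', l') = (Suc i, j)")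
      case False
      note kl' = False
      show ?thesis
      proof (cases "(k, l) = (Suc i, j)")
        case True
        then show ?thesis
          using ordered_offD[OF ord, of i j k' l'] D kl' le u new old[of "(k', l')"]
          by (auto split: if_splits)
      next
        case False
        then show ?thesis
          using ordered_offD[OF ord, of k l k' l'] D kl' le old by simp
      qed
    next
      case True
      note kl' = True
      show ?thesis
      proof (cases "(k, l) = (Suc i, j)")
        case False
        note kl = False
        have o: "excess ?R (k, l) = excess R (k, l)" using old[of "(k, l)"] D False by simp
        show ?thesis
        proof (cases "k = Suc i")
          case True
          then obtain m where m: "j = Suc m" "l \<le> m" using le kl kl' by (cases j) auto
          then have sD: "(Suc i, m) \<in> D"
            using convex[of k l "Suc i" j "Suc i" m] D le True h by simp
          then show ?thesis
            using ordered_offD[OF ord, of k l "Suc i" m] m True D le kl kl' new o l'[OF sD]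
            by (auto split: if_splits)
        next
          case False
          then have "k \<le> i" using le kl' by simp
          then show ?thesis
            using ordered_offD[OF ord, of k l i j] D le kl kl' new o u by (auto split: if_splits)
        qed
      qed (use kl' in simp)
    qed
  qed
qed

section \<open>Staircases and the invariant of a \<open>\<Phi>\<close>-slide\<close>

text \<open>The inequality in the definition says that the excess at \<open>(f c - 1, Suc c)\<close> is at least the one at
  \<open>(f c, c)\<close>, so that a hole at \<open>(f c - 1, c)\<close> prefers to go right and a hole at \<open>(f c, Suc c)\<close> prefers
  to go left.\<close>

definition wall :: "filling \<Rightarrow> cell \<Rightarrow> cell \<Rightarrow> bool" where
  "wall R p q \<longleftrightarrow> (\<exists>f.
     (\<forall>c. snd p \<le> c \<longrightarrow> c < snd q \<longrightarrow>
        fst p < f c \<and> f c \<le> fst q \<and> R (f c, c) + 2 \<le> R (f c - 1, Suc c)) \<and>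
     (\<forall>c c'. snd p \<le> c \<longrightarrow> c \<le> c' \<longrightarrow> c' < snd q \<longrightarrow> f c \<le> f c'))"

text \<open>The staircase traced by a slide from \<open>p\<close> to \<open>h\<close>:
  \<open>f c\<close> is the row in which the hole left column \<open>c\<close>. The inequality is
  conditional because the cell above the right neighbour may lie outside the shape.\<close>

definition phi_trail :: "filling \<Rightarrow> cell \<Rightarrow> cell \<Rightarrow> bool" where
  "phi_trail R p h \<longleftrightarrow> (\<exists>f.
     (\<forall>c. snd p \<le> c \<longrightarrow> c < snd h \<longrightarrow> fst p \<le> f c \<and> f c \<le> fst h \<and>
        ((f c - 1, Suc c) \<in> D \<longrightarrow> R (f c, c) + 2 \<le> R (f c - 1, Suc c))) \<and>
     (\<forall>c c'. snd p \<le> c \<longrightarrow> c \<le> c' \<longrightarrow> c' < snd h \<longrightarrow> f c \<le> f c'))"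

text \<open>The slide started at \<open>p\<^sub>0\<close> in \<open>R\<^sub>0\<close> and has its
  hole at \<open>h\<close>. The clauses on the upper and left neighbours of \<open>h\<close> are
  half of the tableau conditions there; the stopping condition supplies the other half. Excesses are
  strictly below \<open>e\<close> from the starting row downwards, which drives the reverse slide
  up. The last clause says that the hole has not crossed any old wall starting at
  \<open>p\<^sub>0\<close>.\<close>

definition phi_inv :: "filling \<Rightarrow> cell \<Rightarrow> int \<Rightarrow> filling \<times> cell \<Rightarrow> bool" where
  "phi_inv R\<^sub>0 p\<^sub>0 e = (\<lambda>(R, h).
     p\<^sub>0 \<in> D \<and> h \<in> D \<and> fst p\<^sub>0 \<le> fst h \<and> snd p\<^sub>0 \<le> snd h \<and>
     ordered_off h R \<and> R h = e \<and> R \<in> tabloids D \<and>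
     (\<forall>p\<in>D - {h}. excess R p \<le> e \<and> (fst p\<^sub>0 \<le> fst p \<longrightarrow> excess R p < e)) \<and>
     (\<forall>k. (k, snd h) \<in> D \<longrightarrow> Suc k = fst h \<longrightarrow> e < R (k, snd h)) \<and>
     (\<forall>l. (fst h, l) \<in> D \<longrightarrow> Suc l = snd h \<longrightarrow> e \<le> R (fst h, l)) \<and>
     (\<forall>p. fst p < fst p\<^sub>0 \<or> fst h < fst p \<or> snd h < snd p \<longrightarrow> R p = R\<^sub>0 p) \<and>
     (\<forall>p. R p = R\<^sub>0 p \<or> e \<le> R p \<and> snd p \<le> snd h) \<and>
     sum R D + (a + content h) = sum R\<^sub>0 D \<and>
     phi_trail R p\<^sub>0 h \<and>
     (\<forall>q\<in>D. wall R\<^sub>0 p\<^sub>0 q \<longrightarrow> wall R\<^sub>0 h q))"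

lemma sum_fun_upd2:
  assumes "p \<in> D" "q \<in> D" "p \<noteq> q"
  shows "sum (R(p := v, q := w)) D = sum R D - R p - R q + (v + w :: int)"
proof -
  have *: "sum F D = F p + F q + sum F (D - {p, q})" for F :: "cell \<Rightarrow> int"
    using sum.remove[OF finite assms(1), of F] sum.remove[of "D - {p}" q F] finite assms
    by (simp add: Diff_insert2[of D p "{q}", symmetric] insert_commute)
  show ?thesis unfolding *[of R] *[of "R(p := v, q := w)"] using assms by simp
qed

text \<open>\<open>\<Psi>\<close> would move the hole back left: the entry above the new hole, if
  there is one, exceeds the old entry \<open>R (i, Suc j)\<close> by column strictness, and that is
  the comparison which \<open>\<Psi>\<close> makes. Its loop condition holds since the moved entry
  has excess at most \<open>e\<close>.\<close>

lemma phi_inv_right: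
  assumes inv: "phi_inv R\<^sub>0 p\<^sub>0 e (R, (i, j))" and r: "(i, Suc j) \<in> D"
    and e: "e < R (i, Suc j)" and d: "(Suc i, j) \<in> D \<Longrightarrow> R (Suc i, j) + 1 < R (i, Suc j)"
  defines "R' \<equiv> R((i, j) := R (i, Suc j) - 1, (i, Suc j) := e)"
  shows "phi_inv R\<^sub>0 p\<^sub>0 e (R', (i, Suc j))" and "psi_slide_cond a D e (R', (i, Suc j))"
    and "psi_slide_step D e (R', (i, Suc j)) = (R, (i, j))"
proof -
  have p0: "p\<^sub>0 \<in> D" and h: "(i, j) \<in> D" and le: "fst p\<^sub>0 \<le> i" "snd p\<^sub>0 \<le> j"
    and ord: "ordered_off (i, j) R" and Rh: "R (i, j) = e" and tab: "R \<in> tabloids D"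
    and ex: "\<And>p. p \<in> D \<Longrightarrow> p \<noteq> (i, j) \<Longrightarrow> excess R p \<le> e"
      "\<And>p. p \<in> D \<Longrightarrow> p \<noteq> (i, j) \<Longrightarrow> fst p\<^sub>0 \<le> fst p \<Longrightarrow> excess R p < e"
    and unch: "\<And>p. fst p < fst p\<^sub>0 \<or> i < fst p \<or> j < snd p \<Longrightarrow> R p = R\<^sub>0 p"
    and ch: "\<And>p. R p = R\<^sub>0 p \<or> e \<le> R p \<and> snd p \<le> j"
    and sum: "sum R D + (a + content (i, j)) = sum R\<^sub>0 D"
    and trail: "phi_trail R p\<^sub>0 (i, j)"
    and walls: "\<And>q. q \<in> D \<Longrightarrow> wall R\<^sub>0 p\<^sub>0 q \<Longrightarrow> wall R\<^sub>0 (i, j) q"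
    by (insert inv[unfolded phi_inv_def prod.case fst_conv snd_conv], blast)+
  have e0: "0 \<le> e" using tab h Rh unfolding tabloids_def by auto
  have above: "R (i, Suc j) < R (k, Suc j)" if "(k, Suc j) \<in> D" "k < i" for k
    using ordered_offD[OF ord that(1) r] that by (simp add: excess_pair)
  have new: "excess R' (i, j) = excess R (i, Suc j)" by (simp add: excess_pair R'_def)
  have old: "excess R' p = excess R p" if "p \<noteq> (i, j)" "p \<noteq> (i, Suc j)" for p
    using that by (simp add: excess_def R'_def)
  have ij: "0 < i" using index_pos[OF h] by simp
  show "phi_inv R\<^sub>0 p\<^sub>0 e (R', (i, Suc j))"
    unfolding phi_inv_def prod.case
  proof (intro conjI allI ballI impI)
    show "ordered_off (i, Suc j) R'" unfolding R'_def by (rule ordered_off_right[OF ord h r d])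
    show "R' \<in> tabloids D" using tab h r e e0 unfolding tabloids_def R'_def by auto
    show "excess R' p \<le> e" if "p \<in> D - {(i, Suc j)}" for p
      using that ex(1)[of p] ex(1)[OF r] new old[of p] by (cases "p = (i, j)") auto
    show "excess R' p < e" if "p \<in> D - {(i, Suc j)}" "fst p\<^sub>0 \<le> fst p" for p
      using that ex(2)[of p] ex(2)[OF r] new old[of p] by (cases "p = (i, j)") auto
    show "e < R' (k, snd (i, Suc j))" if "(k, snd (i, Suc j)) \<in> D" "Suc k = fst (i, Suc j)" for k
      using above[of k] that e by (auto simp: R'_def)
    show "R' p = R\<^sub>0 p \<or> e \<le> R' p \<and> snd p \<le> snd (i, Suc j)" for p
      using ch[of p] e by (auto simp: R'_def)
    show "sum R' D + (a + content (i, Suc j)) = sum R\<^sub>0 D"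
      using sum sum_fun_upd2[OF h r] Rh by (simp add: R'_def content_def)
    show "phi_trail R' p\<^sub>0 (i, Suc j)"
    proof -
      from trail obtain f where f: "\<And>c. snd p\<^sub>0 \<le> c \<Longrightarrow> c < j \<Longrightarrow> fst p\<^sub>0 \<le> f c \<and> f c \<le> i \<and>
          ((f c - 1, Suc c) \<in> D \<longrightarrow> R (f c, c) + 2 \<le> R (f c - 1, Suc c))"
        and mono: "\<And>c c'. snd p\<^sub>0 \<le> c \<Longrightarrow> c \<le> c' \<Longrightarrow> c' < j \<Longrightarrow> f c \<le> f c'"
        unfolding phi_trail_def by auto
      show ?thesis
        unfolding phi_trail_def
      \<comment> \<open>The hole leaves column \<open>j\<close> in row \<open>i\<close>, weakly
        below all earlier steps. The new entry at \<open>(i, j)\<close> is one less than the old one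
        at \<open>(i, Suc j)\<close>, which is less than the entry above it; this gives the gap of
        2.\<close>
      proof (intro exI[of _ "f(j := i)"] conjI allI impI)
        fix c assume c: "snd p\<^sub>0 \<le> c" "c < snd (i, Suc j)"
        then have "c = j \<or> c < j" by auto
        then show "fst p\<^sub>0 \<le> (f(j := i)) c" "(f(j := i)) c \<le> fst (i, Suc j)"
          using f[OF c(1)] le by auto
        assume D: "((f(j := i)) c - 1, Suc c) \<in> D"
        show "R' ((f(j := i)) c, c) + 2 \<le> R' ((f(j := i)) c - 1, Suc c)"
        proof (cases "c = j")
          case True
          then show ?thesis using above[of "i - 1"] D ij less_not_refl2[of "i - 1" i] by (simp add: R'_def)
        next
          case False
          then have "c < j" using c by simp
          moreover have "f c - 1 \<noteq> i" using f[OF c(1) \<open>c < j\<close>] ij by auto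
          ultimately show ?thesis using f[OF c(1)] D by (auto simp: R'_def)
        qed
      qed (use f mono in auto)
    qed
    \<comment> \<open>A move to the right only drops column \<open>j\<close> from the range, so the
      same staircase serves.\<close>
    show "wall R\<^sub>0 (i, Suc j) q" if "q \<in> D" "wall R\<^sub>0 p\<^sub>0 q" for q
    proof -
      from walls[OF that] obtain f where "\<forall>c. j \<le> c \<longrightarrow> c < snd q \<longrightarrow>
          i < f c \<and> f c \<le> fst q \<and> R\<^sub>0 (f c, c) + 2 \<le> R\<^sub>0 (f c - 1, Suc c)"
        "\<forall>c c'. j \<le> c \<longrightarrow> c \<le> c' \<longrightarrow> c' < snd q \<longrightarrow> f c \<le> f c'"
        unfolding wall_def by auto
      then show ?thesis
        unfolding wall_def by (intro exI[of _ f]) auto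
    qed
  qed (use p0 r le e unch in \<open>auto simp: R'_def\<close>)
  show "psi_slide_cond a D e (R', (i, Suc j))"
    using ex(1)[OF r] h by (simp add: psi_slide_cond_def excess_def R'_def content_def)
  show "psi_slide_step D e (R', (i, Suc j)) = (R, (i, j))"
    using above[of "i - 1"] h r ij Rh by (auto simp: psi_slide_step_def Let_def R'_def fun_eq_iff)
qed

text \<open>\<open>\<Psi>\<close> would move the hole back up: the left neighbour of the new hole,
  if there is one, is at least the old entry \<open>R (Suc i, j)\<close>. Its loop condition uses
  that the moved entry has excess strictly below \<open>e\<close>.\<close>

lemma phi_inv_down:
  assumes inv: "phi_inv R\<^sub>0 p\<^sub>0 e (R, (i, j))" and d: "(Suc i, j) \<in> D"
    and e: "e \<le> R (Suc i, j)" and r: "(i, Suc j) \<in> D \<Longrightarrow> R (i, Suc j) - 1 \<le> R (Suc i, j)"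
  defines "R' \<equiv> R((i, j) := R (Suc i, j) + 1, (Suc i, j) := e)"
  shows "phi_inv R\<^sub>0 p\<^sub>0 e (R', (Suc i, j))" and "psi_slide_cond a D e (R', (Suc i, j))"
    and "psi_slide_step D e (R', (Suc i, j)) = (R, (i, j))"
proof -
  have p0: "p\<^sub>0 \<in> D" and h: "(i, j) \<in> D" and le: "fst p\<^sub>0 \<le> i" "snd p\<^sub>0 \<le> j"
    and ord: "ordered_off (i, j) R" and Rh: "R (i, j) = e" and tab: "R \<in> tabloids D"
    and ex: "\<And>p. p \<in> D \<Longrightarrow> p \<noteq> (i, j) \<Longrightarrow> excess R p \<le> e"
      "\<And>p. p \<in> D \<Longrightarrow> p \<noteq> (i, j) \<Longrightarrow> fst p\<^sub>0 \<le> fst p \<Longrightarrow> excess R p < e"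
    and unch: "\<And>p. fst p < fst p\<^sub>0 \<or> i < fst p \<or> j < snd p \<Longrightarrow> R p = R\<^sub>0 p"
    and ch: "\<And>p. R p = R\<^sub>0 p \<or> e \<le> R p \<and> snd p \<le> j"
    and sum: "sum R D + (a + content (i, j)) = sum R\<^sub>0 D"
    and trail: "phi_trail R p\<^sub>0 (i, j)"
    and walls: "\<And>q. q \<in> D \<Longrightarrow> wall R\<^sub>0 p\<^sub>0 q \<Longrightarrow> wall R\<^sub>0 (i, j) q"
    by (insert inv[unfolded phi_inv_def prod.case fst_conv snd_conv], blast)+
  have e0: "0 \<le> e" using tab h Rh unfolding tabloids_def by auto
  have left: "R (Suc i, j) \<le> R (Suc i, l)" if "(Suc i, l) \<in> D" "j = Suc l" for l
    using ordered_offD[OF ord that(1) d] that by (simp add: excess_pair)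
  have new: "excess R' (i, j) = excess R (Suc i, j)" by (simp add: excess_pair R'_def)
  have old: "excess R' p = excess R p" if "p \<noteq> (i, j)" "p \<noteq> (Suc i, j)" for p
    using that by (simp add: excess_def R'_def)
  have ij: "0 < i" "0 < j" using index_pos[OF h] by simp_all
  show "phi_inv R\<^sub>0 p\<^sub>0 e (R', (Suc i, j))"
    unfolding phi_inv_def prod.case
  proof (intro conjI allI ballI impI)
    show "ordered_off (Suc i, j) R'" unfolding R'_def by (rule ordered_off_down[OF ord h d r])
    show "R' \<in> tabloids D" using tab h d e e0 unfolding tabloids_def R'_def by auto
    show "excess R' p \<le> e" if "p \<in> D - {(Suc i, j)}" for p
      using that ex(1)[of p] ex(1)[OF d] new old[of p] by (cases "p = (i, j)") auto
    show "excess R' p < e" if "p \<in> D - {(Suc i, j)}" "fst p\<^sub>0 \<le> fst p" for p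
      using that ex(2)[of p] ex(2)[OF d] le new old[of p] by (cases "p = (i, j)") auto
    show "e \<le> R' (fst (Suc i, j), l)" if "(fst (Suc i, j), l) \<in> D" "Suc l = snd (Suc i, j)" for l
      using left[of l] that e by (auto simp: R'_def)
    show "R' p = R\<^sub>0 p \<or> e \<le> R' p \<and> snd p \<le> snd (Suc i, j)" for p
      using ch[of p] e by (auto simp: R'_def)
    show "sum R' D + (a + content (Suc i, j)) = sum R\<^sub>0 D"
      using sum sum_fun_upd2[OF h d] Rh by (simp add: R'_def content_def)
    show "phi_trail R' p\<^sub>0 (Suc i, j)"
    proof -
      from trail obtain f where f: "\<And>c. snd p\<^sub>0 \<le> c \<Longrightarrow> c < j \<Longrightarrow> fst p\<^sub>0 \<le> f c \<and> f c \<le> i \<and>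
          ((f c - 1, Suc c) \<in> D \<longrightarrow> R (f c, c) + 2 \<le> R (f c - 1, Suc c))"
        and mono: "\<And>c c'. snd p\<^sub>0 \<le> c \<Longrightarrow> c \<le> c' \<Longrightarrow> c' < j \<Longrightarrow> f c \<le> f c'"
        unfolding phi_trail_def by auto
      show ?thesis
        unfolding phi_trail_def
      proof (intro exI[of _ f] conjI allI impI)
        fix c assume c: "snd p\<^sub>0 \<le> c" "c < snd (Suc i, j)"
        assume D: "(f c - 1, Suc c) \<in> D"
        \<comment> \<open>The inequalities of the trail involve columns left of \<open>j\<close>, or
          rows above \<open>i\<close>; both overwritten cells are missed.\<close>
        have "f c - 1 \<noteq> i" "f c - 1 \<noteq> Suc i" using f[OF c(1)] c(2) ij by auto
        then show "R' (f c, c) + 2 \<le> R' (f c - 1, Suc c)"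
          using f[OF c(1)] c(2) D by (auto simp: R'_def)
      qed (use f mono in \<open>auto intro: le_SucI\<close>)
    qed
    show "wall R\<^sub>0 (Suc i, j) q" if q: "q \<in> D" "wall R\<^sub>0 p\<^sub>0 q" for q
    proof -
      from walls[OF q] obtain f where f: "\<And>c. j \<le> c \<Longrightarrow> c < snd q \<Longrightarrow>
          i < f c \<and> f c \<le> fst q \<and> R\<^sub>0 (f c, c) + 2 \<le> R\<^sub>0 (f c - 1, Suc c)"
        and mono: "\<And>c c'. j \<le> c \<Longrightarrow> c \<le> c' \<Longrightarrow> c' < snd q \<Longrightarrow> f c \<le> f c'"
        unfolding wall_def by auto
      have "Suc i < f c" if c: "j \<le> c" "c < snd q" for c
      proof -
        \<comment> \<open>A wall directly below the hole would require
          \<open>R\<^sub>0 (Suc i, j) + 2 \<le> R\<^sub>0 (i, Suc j)\<close>. Both entries are still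
          untouched, so the hole would have preferred to go right. Monotonicity carries the bound
          over to the later columns.\<close>
        have "f j \<noteq> Suc i"
        proof
          assume *: "f j = Suc i"
          have "(i, Suc j) \<in> D"
            using convex[OF h, of "fst q" "snd q" i "Suc j"] q(1) f[of j] c * by auto
          then show False using r f[of j] c unch[of "(i, Suc j)"] unch[of "(Suc i, j)"] * by auto
        qed
        then show ?thesis using f[of j] mono[of j c] c by auto
      qed
      then show ?thesis
        using f mono unfolding wall_def by (intro exI[of _ f]) auto
    qed
  qed (use p0 d le e unch in \<open>auto simp: R'_def\<close>)
  show "psi_slide_cond a D e (R', (Suc i, j))"
    using ex(2)[OF d] le h by (simp add: psi_slide_cond_def excess_def R'_def content_def)
  show "psi_slide_step D e (R', (Suc i, j)) = (R, (i, j))"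
    using left[of "j - 1"] h d ij Rh by (auto simp: psi_slide_step_def Let_def R'_def fun_eq_iff)
qed

lemma phi_inv_step:
  assumes inv: "phi_inv R\<^sub>0 p\<^sub>0 e s" and cond: "phi_slide_cond D e s"
  shows "phi_inv R\<^sub>0 p\<^sub>0 e (phi_slide_step D e s) \<and> psi_slide_cond a D e (phi_slide_step D e s) \<and>
    psi_slide_step D e (phi_slide_step D e s) = s \<and>
    fst (snd s) + snd (snd s) < fst (snd (phi_slide_step D e s)) + snd (snd (phi_slide_step D e s))"
proof -
  obtain R i j where s: "s = (R, (i, j))" by (cases s) auto
  show ?thesis
  proof (cases "(i, Suc j) \<in> D \<and> ((Suc i, j) \<in> D \<longrightarrow> R (Suc i, j) + 1 < R (i, Suc j))")
    case True
    then have "phi_slide_step D e s = (R((i, j) := R (i, Suc j) - 1, (i, Suc j) := e), (i, Suc j))"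
      unfolding s phi_slide_step_def by (auto simp: Let_def)
    \<comment> \<open>If the loop goes on because of the lower entry \<open>y\<close>, then
      \<open>e \<le> y < x - 1\<close> for the right entry \<open>x\<close>.\<close>
    moreover have "e < R (i, Suc j)" using cond True unfolding s phi_slide_cond_def by auto
    ultimately show ?thesis using phi_inv_right[OF inv[unfolded s]] True s by auto
  next
    case False
    then have d: "(Suc i, j) \<in> D" "(i, Suc j) \<in> D \<Longrightarrow> R (i, Suc j) - 1 \<le> R (Suc i, j)"
      using cond unfolding s phi_slide_cond_def by auto
    then have "phi_slide_step D e s = (R((i, j) := R (Suc i, j) + 1, (Suc i, j) := e), (Suc i, j))"
      unfolding s phi_slide_step_def by (auto simp: Let_def)
    \<comment> \<open>If the loop goes on because of the right entry \<open>x\<close>, then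
      \<open>e < x \<le> y + 1\<close> for the lower entry \<open>y\<close>.\<close>
    moreover have "e \<le> R (Suc i, j)" using cond d unfolding s phi_slide_cond_def by auto
    ultimately show ?thesis using phi_inv_down[OF inv[unfolded s]] d s by auto
  qed
qed

section \<open>One round of \<open>\<Phi>\<close>\<close>

definition linked :: "filling \<Rightarrow> filling \<Rightarrow> bool" where
  "linked R T \<longleftrightarrow> (\<forall>q\<in>D. T q \<noteq> 0 \<longrightarrow>
     (\<forall>p\<in>D. excess R p \<le> R q \<and> (excess R p = R q \<longrightarrow> wall R p q)))"

text \<open>Otherwise the wall, which by the invariant still runs from \<open>h\<close> to
  \<open>q\<close>, would have a step below \<open>h\<close> in the column of \<open>h\<close>. So
  there is a cell below \<open>h\<close>; it is unchanged and lies weakly above and left of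
  \<open>q\<close>, hence its entry is at least \<open>e\<close>, and the slide would go on.\<close>

lemma phi_slide_end_column:
  assumes R0: "R\<^sub>0 \<in> reverse_ssyts D" and inv: "phi_inv R\<^sub>0 p\<^sub>0 e (R, h)"
    and stop: "\<not> phi_slide_cond D e (R, h)"
    and q: "q \<in> D" "R\<^sub>0 q = e" "wall R\<^sub>0 p\<^sub>0 q"
  shows "snd q \<le> snd h"
proof (rule ccontr)
  obtain i j where ij: "h = (i, j)" by (cases h)
  obtain i' j' where ij': "q = (i', j')" by (cases q)
  assume "\<not> snd q \<le> snd h"
  then have less: "j < j'" using ij ij' by simp
  have h: "(i, j) \<in> D" and unch: "\<And>p. i < fst p \<Longrightarrow> R p = R\<^sub>0 p" and "wall R\<^sub>0 (i, j) q"
    using inv q unfolding ij phi_inv_def prod.case fst_conv snd_conv by blast+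
  then obtain k where k: "i < k" "k \<le> i'" unfolding wall_def using less ij' by auto
  have k': "(k, j) \<in> D" "(Suc i, j) \<in> D"
    using convex[OF h, of i' j'] k less q ij' by auto
  have "e \<le> R\<^sub>0 (Suc i, j)"
    using rssyt_leD[OF R0 k'(2), of i' j'] k less q ij' by auto
  then show False
    using stop k' unch[of "(Suc i, j)"] unfolding ij phi_slide_cond_def by auto
qed

text \<open>The hole moves right or down in a finite shape, so the sum of its coordinates bounds the
  number of moves. Every move is undone by a move of \<open>\<Psi>\<close>, so the reversal lemma
  for loops gives the slide back to \<open>p\<close>.\<close>

lemma phi_slide_correct:
  assumes R: "R \<in> reverse_ssyts D" and p: "p \<in> D" "excess R p = e" and e: "0 \<le> e"
    and ex: "\<And>q. q \<in> D \<Longrightarrow> excess R q \<le> e"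
    and bottom: "\<And>q. q \<in> D \<Longrightarrow> excess R q = e \<Longrightarrow> fst q \<le> fst p"
  obtains R' h where "phi_slide D e R p = Some (R', h)" "psi_slide a D e R' h = Some (R(p := e), p)"
    "phi_inv R p e (R', h)" "\<not> phi_slide_cond D e (R', h)" "R' \<in> reverse_ssyts D"
proof -
  obtain i j where ij: "p = (i, j)" by (cases p)
  have Rp: "R p = e + (a + content p)" using p by (simp add: excess_def)
  have wp: "0 < a + content p" using weight_pos p by simp
  have above: "R p < R (k, j)" if "(k, j) \<in> D" "k < i" for k
    using rssyt_leD[OF R that(1), of i j] p that ij by simp
  have left: "R p \<le> R (i, l)" if "(i, l) \<in> D" "l < j" for l
    using rssyt_leD[OF R that(1), of i j] p that ij by simp
  have right: "R (i, l) \<le> R p" if "(i, l) \<in> D" "j < l" for l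
    using rssyt_leD[OF R, of i j i l] p that ij by simp
  define s where "s = (R(p := e), p)"
  have inv: "phi_inv R p e s"
    unfolding phi_inv_def s_def prod.case
  proof (intro conjI allI ballI impI)
    show "ordered_off p (R(p := e))" using R by (rule rssyt_ordered_off)
    show "R(p := e) \<in> tabloids D" using R p e unfolding reverse_ssyts_def tabloids_def by auto
    show "excess (R(p := e)) q \<le> e" if "q \<in> D - {p}" for q
      using ex[of q] that by (simp add: excess_def)
    show "excess (R(p := e)) q < e" if q: "q \<in> D - {p}" "fst p \<le> fst q" for q
    proof (rule ccontr)
      obtain k l where kl: "q = (k, l)" by (cases q)
      assume "\<not> excess (R(p := e)) q < e"
      then have *: "excess R q = e" using ex[of q] q by (simp add: excess_def)
      \<comment> \<open>The choice of the bottommost cell leaves only the row of \<open>p\<close>,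
        and along a row excesses are strictly decreasing.\<close>
      then have "k = i" using bottom[of q] q kl ij by simp
      then show False
        using rssyt_excess[OF R, of i j i l] rssyt_excess[OF R, of i l i j] p q kl ij *
        by (cases l j rule: linorder_cases) auto
    qed
    show "e < (R(p := e)) (k, snd p)" if "(k, snd p) \<in> D" "Suc k = fst p" for k
      using above[of k] that ij Rp wp by auto
    show "e \<le> (R(p := e)) (fst p, l)" if "(fst p, l) \<in> D" "Suc l = snd p" for l
      using left[of l] that ij Rp wp by auto
    show "sum (R(p := e)) D + (a + content p) = sum R D"
      using sum.remove[OF finite p(1), of "R(p := e)"] sum.remove[OF finite p(1), of R] Rp by simp
    show "phi_trail (R(p := e)) p p" unfolding phi_trail_def by auto
  qed (use p in auto)
  obtain N where N: "\<And>q. q \<in> D \<Longrightarrow> fst q + snd q \<le> N"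
    using finite_imageI[OF finite, of "\<lambda>q. fst q + snd q"] by (auto simp: finite_nat_set_iff_bounded_le)
  let ?b = "phi_slide_cond D e" and ?c = "phi_slide_step D e"
  obtain t where t: "while_option ?b ?c s = Some t"
  proof -
    have "\<exists>t. while_option ?b ?c s = Some t"
    proof (rule measure_while_option_Some[where P = "phi_inv R p e"
          and f = "\<lambda>s. N - (fst (snd s) + snd (snd s))"])
      fix s assume s: "phi_inv R p e s" "?b s"
      from phi_inv_step[OF this]
      have *: "phi_inv R p e (?c s)"
        "fst (snd s) + snd (snd s) < fst (snd (?c s)) + snd (snd (?c s))" by simp_all
      then have "snd (?c s) \<in> D" by (auto simp: phi_inv_def)
      then show "phi_inv R p e (?c s) \<and>
          N - (fst (snd (?c s)) + snd (snd (?c s))) < N - (fst (snd s) + snd (snd s))"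
        using * N[of "snd (?c s)"] by auto
    qed (fact inv)
    then show ?thesis using that by blast
  qed
  obtain R' h where t': "t = (R', h)" by (cases t)
  have inv': "phi_inv R p e (R', h)"
    using while_option_rule[OF _ t, of "phi_inv R p e"] phi_inv_step inv t' by blast
  have stop: "\<not> ?b (R', h)" using while_option_stop[OF t] t' by simp
  \<comment> \<open>At \<open>p\<close> the algorithm compares with
    \<open>e + a + content p\<close>, which is the entry \<open>R p\<close> that was taken out; the
    comparisons fail because \<open>R\<close> is a tableau.\<close>
  have stop': "\<not> psi_slide_cond a D e s"
    unfolding s_def psi_slide_cond_def ij using above[of "i - 1"] left[of "j - 1"] Rp index_pos[of i j] p
    by (auto simp: ij add.assoc)
  have reverse: "while_option (psi_slide_cond a D e) (psi_slide_step D e) t = Some s"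
    by (rule while_option_reverse[where P = "phi_inv R p e", OF t inv]) (simp_all add: phi_inv_step stop')
  have "R' \<in> reverse_ssyts D"
  proof -
    obtain i' j' where h: "h = (i', j')" by (cases h)
    have *: "R' \<in> tabloids D" "ordered_off h R'" "R' h = e"
      "\<And>k. (k, snd h) \<in> D \<Longrightarrow> Suc k = fst h \<Longrightarrow> e < R' (k, snd h)"
      "\<And>l. (fst h, l) \<in> D \<Longrightarrow> Suc l = snd h \<Longrightarrow> e \<le> R' (fst h, l)"
      by (insert inv'[unfolded phi_inv_def prod.case], blast)+
    show ?thesis
      by (rule rssyt_fill_hole[OF *(1) *(2)[unfolded h]])
        (use * h stop in \<open>auto simp: phi_slide_cond_def\<close>)
  qed
  then show ?thesis
    using that[of R' h] t t' inv' stop reverse unfolding phi_slide_def psi_slide_def s_def by simp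
qed

lemma phi_max_excess: "phi_max a D R = Max (excess R ` D)"
  by (simp add: phi_max_def excess_def)

text \<open>Besides preserving the invariant, the round ends in the very cell that
  \<open>\<Psi>\<close> selects next. The end cell has entry \<open>e\<close> and is now marked, no
  marked entry is smaller, and marked cells with entry \<open>e\<close> lie in no later
  column.\<close>

lemma phi_step:
  assumes R: "R \<in> reverse_ssyts D" and linked: "linked R T" and T: "T \<in> tabloids D"
    and D: "D \<noteq> {}" and e: "e = phi_max a D R" "0 \<le> e"
  obtains p R' h where "phi_select a D R e = Some p" "phi_slide D e R p = Some (R', h)"
    "R' \<in> reverse_ssyts D" "h \<in> D" "linked R' (T(h := T h + 1))"
    "sum R' D + (a + content h) = sum R D"
    "psi_min D R' (T(h := T h + 1)) = e" "psi_select D R' (T(h := T h + 1)) e = Some h"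
    "psi_slide a D e R' h = Some (R(p := e), p)" "R p = e + (a + content p)"
proof -
  have ex: "excess R q \<le> e" if "q \<in> D" for q
    using that finite e(1) by (simp add: phi_max_excess)
  let ?E = "{q \<in> D. excess R q = e}"
  have E: "?E \<noteq> {}"
  proof -
    have "e \<in> excess R ` D" using Max_in[of "excess R ` D"] finite D e(1) by (simp add: phi_max_excess)
    then show ?thesis by auto
  qed
  have "finite ?E" using finite by simp
  from finite_ex_maximal[OF this E, of fst]
  obtain p where "p \<in> ?E" "\<forall>q\<in>?E. fst q \<le> fst p" by blast
  then have p: "p \<in> D" "excess R p = e" and bottom: "\<And>q. q \<in> D \<Longrightarrow> excess R q = e \<Longrightarrow> fst q \<le> fst p"
    by auto
  obtain R' h where slide: "phi_slide D e R p = Some (R', h)"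
      "psi_slide a D e R' h = Some (R(p := e), p)"
    and inv: "phi_inv R p e (R', h)" and stop: "\<not> phi_slide_cond D e (R', h)"
    and R': "R' \<in> reverse_ssyts D"
    using phi_slide_correct[OF R p e(2) ex bottom] by metis
  from inv have h: "h \<in> D" and le: "fst p \<le> fst h" "snd p \<le> snd h"
    and R'h: "R' h = e"
    and ex': "\<And>q. q \<in> D \<Longrightarrow> q \<noteq> h \<Longrightarrow> excess R' q \<le> e"
      "\<And>q. q \<in> D \<Longrightarrow> q \<noteq> h \<Longrightarrow> fst p \<le> fst q \<Longrightarrow> excess R' q < e"
    and unch: "\<And>q. fst q < fst p \<Longrightarrow> R' q = R q"
    and ch: "\<And>q. R' q = R q \<or> e \<le> R' q \<and> snd q \<le> snd h"
    and sum: "sum R' D + (a + content h) = sum R D"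
    and trail: "phi_trail R' p h"
    unfolding phi_inv_def prod.case by blast+
  let ?T = "T(h := T h + 1)"
  have exh: "excess R' h < e" using weight_pos[OF h] R'h by (simp add: excess_def)
  \<comment> \<open>Old marks had entries at least \<open>e\<close>, and changed entries stay at
    least \<open>e\<close>. For an entry equal to \<open>e\<close>, either the entry was changed,
    which happens only in columns up to that of \<open>h\<close>, or the old wall stops the slide
    from ending too early.\<close>
  have marked: "e \<le> R' q" "R' q = e \<Longrightarrow> snd q \<le> snd h" if q: "q \<in> D" "?T q \<noteq> 0" for q
  proof -
    have *: "e \<le> R q" "R q = e \<Longrightarrow> wall R p q" if "q \<noteq> h"
      using linked q p that unfolding linked_def by auto
    show "e \<le> R' q" using * ch[of q] R'h by (cases "q = h") auto
    show "snd q \<le> snd h" if "R' q = e"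
      using * ch[of q] that phi_slide_end_column[OF R inv stop q(1)] by (cases "q = h") auto
  qed
  have Th: "?T h \<noteq> 0" using T h by (auto simp: tabloids_def)
  \<comment> \<open>A cell strictly above \<open>h\<close> and weakly to its left has an entry
    greater than \<open>e\<close>.\<close>
  have below: "fst h \<le> fst q" if q: "q \<in> D" "R' q = e" "snd q \<le> snd h" for q
    using rssyt_leD[OF R', of "fst q" "snd q" "fst h" "snd h"] q h R'h by (cases "fst h \<le> fst q") auto
  have "linked R' ?T"
    unfolding linked_def
  proof (intro ballI impI conjI)
    fix q r assume q: "q \<in> D" "?T q \<noteq> 0" and r: "r \<in> D"
    have er: "excess R' r \<le> e" using ex'(1)[OF r] exh by (cases "r = h") auto
    then show "excess R' r \<le> R' q" using marked(1)[OF q] by simp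
    assume "excess R' r = R' q"
    then have eq: "excess R' r = e" "R' q = e" using er marked(1)[OF q] by auto
    then have "r \<noteq> h" using exh by auto
    \<comment> \<open>A remaining cell of excess \<open>e\<close> lies above the starting row, where
      nothing has changed. It is not left of \<open>p\<close>, for there its excess would be greater
      than that of \<open>p\<close>. So the columns from \<open>r\<close> to \<open>q\<close> are
      covered by the trail.\<close>
    then have r_above: "fst r < fst p" using ex'(2)[OF r] eq by force
    then have "excess R r = e" using unch[of r] eq by (simp add: excess_def)
    then have r_right: "snd p \<le> snd r"
      using rssyt_excess[OF R, of "fst r" "snd r" "fst p" "snd p"] r p r_above
      by (cases "snd p \<le> snd r") auto
    have q_left: "snd q \<le> snd h" and q_below: "fst h \<le> fst q"
      using marked(2)[OF q] below[OF q(1)] eq by auto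
    from trail obtain f where f: "\<And>c. snd p \<le> c \<Longrightarrow> c < snd h \<Longrightarrow> fst p \<le> f c \<and> f c \<le> fst h \<and>
        ((f c - 1, Suc c) \<in> D \<longrightarrow> R' (f c, c) + 2 \<le> R' (f c - 1, Suc c))"
      and mono: "\<And>c c'. snd p \<le> c \<Longrightarrow> c \<le> c' \<Longrightarrow> c' < snd h \<Longrightarrow> f c \<le> f c'"
      unfolding phi_trail_def by blast
    show "wall R' r q"
      unfolding wall_def
    \<comment> \<open>The trail, restricted to these columns, is the wall; convexity between
      \<open>r\<close> and \<open>q\<close> discharges its membership condition.\<close>
    proof (intro exI[of _ f] conjI allI impI)
      fix c assume c: "snd r \<le> c" "c < snd q"
      then have c': "snd p \<le> c" "c < snd h" using r_right q_left by auto
      show *: "fst r < f c" "f c \<le> fst q" using f[OF c'] r_above q_below by auto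
      have "(f c - 1, Suc c) \<in> D"
        using convex[of "fst r" "snd r" "fst q" "snd q" "f c - 1" "Suc c"] r q c * by auto
      then show "R' (f c, c) + 2 \<le> R' (f c - 1, Suc c)" using f[OF c'] by simp
    qed (use mono r_right q_left in auto)
  qed
  moreover have "phi_select a D R e = Some p"
    unfolding phi_select_def
  proof (rule the_onlyI)
    show "p \<in> D \<and> R p - (a + content p) = e \<and>
        (\<forall>q\<in>D. R q - (a + content q) = e \<longrightarrow> fst q \<le> fst p)"
      using p bottom by (auto simp: excess_def)
    fix q assume "q \<in> D \<and> R q - (a + content q) = e \<and>
        (\<forall>q'\<in>D. R q' - (a + content q') = e \<longrightarrow> fst q' \<le> fst q)"
    then have q: "q \<in> D" "excess R q = e" "fst p \<le> fst q" using p by (auto simp: excess_def)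
    then have "fst q = fst p" using bottom[of q] by simp
    \<comment> \<open>Two cells of one row cannot have equal excess.\<close>
    then show "q = p"
      using rssyt_excess[OF R, of "fst p" "snd p" "fst p" "snd q"]
        rssyt_excess[OF R, of "fst p" "snd q" "fst p" "snd p"] p q
      by (cases p, cases q, cases "snd p" "snd q" rule: linorder_cases) auto
  qed
  moreover have "psi_min D R' ?T = e"
    unfolding psi_min_def
  proof (rule Min_eqI)
    show "e \<in> R' ` {q \<in> D. ?T q \<noteq> 0}"
      by (rule image_eqI[of _ _ h]) (use R'h h Th in auto)
    show "e \<le> y" if "y \<in> R' ` {q \<in> D. ?T q \<noteq> 0}" for y
      using that marked(1) by blast
  qed (use finite in simp)
  moreover have "psi_select D R' ?T e = Some h"
    unfolding psi_select_def
  proof (rule the_onlyI)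
    show "h \<in> D \<and> R' h = e \<and> ?T h \<noteq> 0 \<and> (\<forall>q\<in>D. R' q = e \<and> ?T q \<noteq> 0 \<longrightarrow> snd q \<le> snd h)"
      using h R'h Th marked(2) by blast
    fix q assume "q \<in> D \<and> R' q = e \<and> ?T q \<noteq> 0 \<and> (\<forall>q'\<in>D. R' q' = e \<and> ?T q' \<noteq> 0 \<longrightarrow> snd q' \<le> snd q)"
    then have q: "q \<in> D" "R' q = e" "snd h \<le> snd q" "snd q \<le> snd h" using h R'h Th marked(2) by blast+
    then show "q = h"
      using below[of q] rssyt_leD[OF R', of "fst h" "snd h" "fst q" "snd q"] h R'h
      by (cases h, cases q) auto
  qed
  ultimately show ?thesis
    using that slide R' h sum p by (simp add: excess_def)
qed

section \<open>The invariant of a \<open>\<Psi>\<close>-slide\<close>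

text \<open>Here \<open>f c - 1\<close> is the row in which the hole left column
  \<open>Suc c\<close>, so the staircase runs just below the path. The bound
  \<open>e < Q (f c - 1, Suc c)\<close> serves to show later that the staircase does not drop below
  a marked cell with entry \<open>e\<close>.\<close>

definition psi_trail :: "int \<Rightarrow> filling \<Rightarrow> cell \<Rightarrow> cell \<Rightarrow> bool" where
  "psi_trail e Q h p \<longleftrightarrow> (\<exists>f.
     (\<forall>c. snd h \<le> c \<longrightarrow> c < snd p \<longrightarrow> fst h < f c \<and> e < Q (f c - 1, Suc c) \<and>
        ((f c, c) \<in> D \<longrightarrow> Q (f c, c) + 2 \<le> Q (f c - 1, Suc c))) \<and>
     (\<forall>c c'. snd h \<le> c \<longrightarrow> c \<le> c' \<longrightarrow> c' < snd p \<longrightarrow> f c \<le> f c'))"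

text \<open>The clause on cells of excess exactly \<open>e\<close> is the crucial one: they stay
  strictly above the hole, on the other side of a wall of the original filling. Hence the end cell
  will be the bottommost cell of excess \<open>e\<close>, the one that \<open>\<Phi>\<close>
  selects.\<close>

definition psi_inv :: "filling \<Rightarrow> cell \<Rightarrow> int \<Rightarrow> filling \<times> cell \<Rightarrow> bool" where
  "psi_inv R\<^sub>0 p\<^sub>0 e = (\<lambda>(Q, h).
     h \<in> D \<and> fst h \<le> fst p\<^sub>0 \<and> snd h \<le> snd p\<^sub>0 \<and>
     ordered_off h Q \<and> Q h = e \<and> Q \<in> tabloids D \<and>
     (\<forall>p\<in>D - {h}. excess Q p \<le> e) \<and>
     (\<forall>p\<in>D - {h}. excess Q p = e \<longrightarrow> fst p < fst h \<and> wall R\<^sub>0 p h) \<and>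
     (\<forall>p. fst p < fst h \<or> snd p < snd h \<longrightarrow> Q p = R\<^sub>0 p) \<and>
     (\<forall>p. Q p = R\<^sub>0 p \<or> e \<le> Q p \<and> snd p \<le> snd p\<^sub>0) \<and>
     psi_trail e Q h p\<^sub>0)"

text \<open>\<open>\<Phi>\<close> would move the hole back right, since the entry below
  \<open>(i, j)\<close>, if there is one, is smaller than the old \<open>Q (i, j)\<close>. Old walls
  merely lose their last column.\<close>

lemma psi_inv_left:
  assumes R0: "R\<^sub>0 \<in> reverse_ssyts D" and p0: "p\<^sub>0 \<in> D" "R\<^sub>0 p\<^sub>0 = e"
    and inv: "psi_inv R\<^sub>0 p\<^sub>0 e (Q, (i, Suc j))" and l: "(i, j) \<in> D"
    and u: "\<And>k. (k, Suc j) \<in> D \<Longrightarrow> i = Suc k \<Longrightarrow> Q (i, j) + 1 < Q (k, Suc j)"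
  defines "Q' \<equiv> Q((i, Suc j) := Q (i, j) + 1, (i, j) := e)"
  shows "psi_inv R\<^sub>0 p\<^sub>0 e (Q', (i, j))" and "phi_slide_cond D e (Q', (i, j))"
    and "phi_slide_step D e (Q', (i, j)) = (Q, (i, Suc j))"
proof -
  have h: "(i, Suc j) \<in> D" and le: "i \<le> fst p\<^sub>0" "Suc j \<le> snd p\<^sub>0"
    and ord: "ordered_off (i, Suc j) Q" and Qh: "Q (i, Suc j) = e" and tab: "Q \<in> tabloids D"
    and ex: "\<And>p. p \<in> D \<Longrightarrow> p \<noteq> (i, Suc j) \<Longrightarrow> excess Q p \<le> e"
    and ex_eq: "\<And>p. p \<in> D \<Longrightarrow> p \<noteq> (i, Suc j) \<Longrightarrow> excess Q p = e \<Longrightarrow> fst p < i"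
      "\<And>p. p \<in> D \<Longrightarrow> p \<noteq> (i, Suc j) \<Longrightarrow> excess Q p = e \<Longrightarrow> wall R\<^sub>0 p (i, Suc j)"
    and unch: "\<And>p. fst p < i \<or> snd p < Suc j \<Longrightarrow> Q p = R\<^sub>0 p"
    and ch: "\<And>p. Q p = R\<^sub>0 p \<or> e \<le> Q p \<and> snd p \<le> snd p\<^sub>0"
    and trail: "psi_trail e Q (i, Suc j) p\<^sub>0"
    by (insert inv[unfolded psi_inv_def prod.case fst_conv snd_conv], blast)+
  \<comment> \<open>This entry is still the original one, weakly above and left of
    \<open>p\<^sub>0\<close>, where the entry is \<open>e\<close>.\<close>
  have e: "e \<le> Q (i, j)"
    using rssyt_leD[OF R0 l, of "fst p\<^sub>0" "snd p\<^sub>0"] p0 le unch[of "(i, j)"] by simp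
  have below: "Q (Suc i, j) < Q (i, j)" if "(Suc i, j) \<in> D"
    using ordered_offD[OF ord l that] by (simp add: excess_pair)
  have new: "excess Q' (i, Suc j) = excess Q (i, j)" by (simp add: excess_pair Q'_def)
  have old: "excess Q' p = excess Q p" if "p \<noteq> (i, j)" "p \<noteq> (i, Suc j)" for p
    using that by (simp add: excess_def Q'_def)
  \<comment> \<open>With equality, the cell would have to lie strictly above row
    \<open>i\<close>.\<close>
  have exl: "excess Q (i, j) < e" using ex[OF l] ex_eq(1)[OF l] by force
  show "psi_inv R\<^sub>0 p\<^sub>0 e (Q', (i, j))"
    unfolding psi_inv_def prod.case
  proof (intro conjI allI ballI impI)
    show "ordered_off (i, j) Q'" unfolding Q'_def by (rule ordered_off_left[OF ord h l u])
    show "Q' \<in> tabloids D" using tab h l Qh unfolding tabloids_def Q'_def by auto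
    show "excess Q' p \<le> e" if "p \<in> D - {(i, j)}" for p
      using that ex[of p] exl new old[of p] by (cases "p = (i, Suc j)") auto
    fix p assume p: "p \<in> D - {(i, j)}" "excess Q' p = e"
    then have "p \<noteq> (i, Suc j)" using exl new by auto
    then have p': "fst p < i" "wall R\<^sub>0 p (i, Suc j)"
      using ex_eq[of p] p old[of p] by auto
    then show "fst p < fst (i, j)" by simp
    from p' obtain f where "\<forall>c. snd p \<le> c \<longrightarrow> c < Suc j \<longrightarrow>
        fst p < f c \<and> f c \<le> i \<and> R\<^sub>0 (f c, c) + 2 \<le> R\<^sub>0 (f c - 1, Suc c)"
      "\<forall>c c'. snd p \<le> c \<longrightarrow> c \<le> c' \<longrightarrow> c' < Suc j \<longrightarrow> f c \<le> f c'"
      unfolding wall_def by auto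
    then show "wall R\<^sub>0 p (i, j)"
      unfolding wall_def by (intro exI[of _ f]) auto
  next
    show "Q' p = R\<^sub>0 p \<or> e \<le> Q' p \<and> snd p \<le> snd p\<^sub>0" for p
      using ch[of p] e le by (auto simp: Q'_def)
    show "psi_trail e Q' (i, j) p\<^sub>0"
    proof -
      from trail obtain f where f: "\<And>c. Suc j \<le> c \<Longrightarrow> c < snd p\<^sub>0 \<Longrightarrow>
          i < f c \<and> e < Q (f c - 1, Suc c) \<and>
          ((f c, c) \<in> D \<longrightarrow> Q (f c, c) + 2 \<le> Q (f c - 1, Suc c))"
        and mono: "\<And>c c'. Suc j \<le> c \<Longrightarrow> c \<le> c' \<Longrightarrow> c' < snd p\<^sub>0 \<Longrightarrow> f c \<le> f c'"
        unfolding psi_trail_def by auto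
      show ?thesis
        unfolding psi_trail_def
      \<comment> \<open>The hole leaves column \<open>Suc j\<close> in row \<open>i\<close>, and the
        staircase is one row lower. The gap of 2 is column strictness at \<open>(i, j)\<close> plus
        the 1 added to the moved entry.\<close>
      proof (intro exI[of _ "f(j := Suc i)"] conjI allI impI)
        fix c assume c: "snd (i, j) \<le> c" "c < snd p\<^sub>0"
        then have "c = j \<or> Suc j \<le> c" by auto
        then show "fst (i, j) < (f(j := Suc i)) c" "e < Q' ((f(j := Suc i)) c - 1, Suc c)"
          using f[of c] c(2) e by (auto simp: Q'_def)
        assume D: "((f(j := Suc i)) c, c) \<in> D"
        show "Q' ((f(j := Suc i)) c, c) + 2 \<le> Q' ((f(j := Suc i)) c - 1, Suc c)"
        proof (cases "c = j")
          case True
          then show ?thesis using below D by (simp add: Q'_def)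
        next
          case False
          then have "Suc j \<le> c" using c by simp
          then show ?thesis using f[OF _ c(2)] D by (auto simp: Q'_def)
        qed
      next
        fix c c' assume c: "snd (i, j) \<le> c" "c \<le> c'" "c' < snd p\<^sub>0"
        show "(f(j := Suc i)) c \<le> (f(j := Suc i)) c'"
        proof (cases "c = j")
          case True
          then show ?thesis using f[of c'] c by (cases "c' = j") (auto simp: Suc_le_eq)
        next
          case False
          then show ?thesis using mono[of c c'] c by auto
        qed
      qed
    qed
  qed (use l le unch in \<open>auto simp: Q'_def\<close>)
  show "phi_slide_cond D e (Q', (i, j))"
    using e h by (simp add: phi_slide_cond_def Q'_def)
  show "phi_slide_step D e (Q', (i, j)) = (Q, (i, Suc j))"
    using below h Qh by (auto simp: phi_slide_step_def Let_def Q'_def fun_eq_iff)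
qed

text \<open>\<open>\<Phi>\<close> would move the hole back down, since the right neighbour of
  \<open>(i, j)\<close> is at most the old \<open>Q (i, j)\<close>. The point to check is that the
  hole does not climb through a wall or reach the row of a cell of excess \<open>e\<close>.\<close>

lemma psi_inv_up:
  assumes R0: "R\<^sub>0 \<in> reverse_ssyts D" and p0: "p\<^sub>0 \<in> D" "R\<^sub>0 p\<^sub>0 = e"
    and inv: "psi_inv R\<^sub>0 p\<^sub>0 e (Q, (Suc i, j))" and u: "(i, j) \<in> D"
    and y: "Q (i, j) \<le> e + a + content (Suc i, j)"
    and l: "\<And>k. (Suc i, k) \<in> D \<Longrightarrow> j = Suc k \<Longrightarrow> Q (i, j) \<le> Q (Suc i, k) + 1"
  defines "Q' \<equiv> Q((Suc i, j) := Q (i, j) - 1, (i, j) := e)"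
  shows "psi_inv R\<^sub>0 p\<^sub>0 e (Q', (i, j))" and "phi_slide_cond D e (Q', (i, j))"
    and "phi_slide_step D e (Q', (i, j)) = (Q, (Suc i, j))"
proof -
  have h: "(Suc i, j) \<in> D" and le: "Suc i \<le> fst p\<^sub>0" "j \<le> snd p\<^sub>0"
    and ord: "ordered_off (Suc i, j) Q" and Qh: "Q (Suc i, j) = e" and tab: "Q \<in> tabloids D"
    and ex: "\<And>p. p \<in> D \<Longrightarrow> p \<noteq> (Suc i, j) \<Longrightarrow> excess Q p \<le> e"
    and ex_eq: "\<And>p. p \<in> D \<Longrightarrow> p \<noteq> (Suc i, j) \<Longrightarrow> excess Q p = e \<Longrightarrow> fst p < Suc i"
      "\<And>p. p \<in> D \<Longrightarrow> p \<noteq> (Suc i, j) \<Longrightarrow> excess Q p = e \<Longrightarrow> wall R\<^sub>0 p (Suc i, j)"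
    and unch: "\<And>p. fst p < Suc i \<or> snd p < j \<Longrightarrow> Q p = R\<^sub>0 p"
    and ch: "\<And>p. Q p = R\<^sub>0 p \<or> e \<le> Q p \<and> snd p \<le> snd p\<^sub>0"
    and trail: "psi_trail e Q (Suc i, j) p\<^sub>0"
    by (insert inv[unfolded psi_inv_def prod.case fst_conv snd_conv], blast)+
  have e: "e \<le> Q (i, j) - 1"
    using rssyt_leD[OF R0 u, of "fst p\<^sub>0" "snd p\<^sub>0"] p0 le unch[of "(i, j)"] by simp
  have e0: "0 \<le> e" using tab h Qh unfolding tabloids_def by auto
  have right: "Q (i, Suc j) \<le> Q (i, j)" if "(i, Suc j) \<in> D"
    using ordered_offD[OF ord u that] by (simp add: excess_pair)
  have new: "excess Q' (Suc i, j) = excess Q (i, j)" by (simp add: excess_pair Q'_def)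
  have old: "excess Q' p = excess Q p" if "p \<noteq> (i, j)" "p \<noteq> (Suc i, j)" for p
    using that by (simp add: excess_def Q'_def)
  have exu: "excess Q (i, j) < e" using y by (simp add: excess_pair content_def)
  show "psi_inv R\<^sub>0 p\<^sub>0 e (Q', (i, j))"
    unfolding psi_inv_def prod.case
  proof (intro conjI allI ballI impI)
    show "ordered_off (i, j) Q'" unfolding Q'_def by (rule ordered_off_up[OF ord h u l])
    show "Q' \<in> tabloids D" using tab h u e e0 unfolding tabloids_def Q'_def by auto
    show "excess Q' p \<le> e" if "p \<in> D - {(i, j)}" for p
      using that ex[of p] exu new old[of p] by (cases "p = (Suc i, j)") auto
    fix p assume p: "p \<in> D - {(i, j)}" "excess Q' p = e"
    obtain k m where km: "p = (k, m)" by (cases p)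
    have p_ne: "p \<noteq> (Suc i, j)" using p exu new by auto
    then have ep: "excess Q p = e" using p old by auto
    then have p': "k \<le> i" "wall R\<^sub>0 p (Suc i, j)"
      using ex_eq[of p] p p_ne km by auto
    from p' obtain f where f: "\<And>c. m \<le> c \<Longrightarrow> c < j \<Longrightarrow>
        k < f c \<and> f c \<le> Suc i \<and> R\<^sub>0 (f c, c) + 2 \<le> R\<^sub>0 (f c - 1, Suc c)"
      and mono: "\<And>c c'. m \<le> c \<Longrightarrow> c \<le> c' \<Longrightarrow> c' < j \<Longrightarrow> f c \<le> f c'"
      unfolding wall_def km by auto
    have f_le: "f c \<le> i" if c: "m \<le> c" "c < j" for c
    proof -
      obtain j' where j': "j = Suc j'" "m \<le> j'" using c by (cases j) auto
      \<comment> \<open>A last step of the wall in row \<open>Suc i\<close> would require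
        \<open>R\<^sub>0 (Suc i, j') + 2 \<le> R\<^sub>0 (i, j)\<close>. Both entries are untouched,
        so this contradicts \<open>l\<close>: the hole would have gone left.\<close>
      have "f j' \<noteq> Suc i"
      proof
        assume *: "f j' = Suc i"
        have "(Suc i, j') \<in> D"
          using convex[of k m "Suc i" j "Suc i" j'] p km h p' j' by auto
        then show False using l[of j'] f[of j'] * j' unch[of "(i, j)"] unch[of "(Suc i, j')"] by auto
      qed
      then show ?thesis using f[of j'] mono[of c j'] c j' by auto
    qed
    \<comment> \<open>Left of column \<open>j\<close> the wall itself keeps \<open>p\<close> above
      row \<open>i\<close>; from column \<open>j\<close> on, a cell of row \<open>i\<close> has
      excess at most that of \<open>(i, j)\<close>, which is below \<open>e\<close>.\<close>
    have "k < i"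
    proof (rule ccontr)
      assume "\<not> k < i"
      then have k: "k = i" using p' by simp
      show False
      proof (cases "m < j")
        case True
        then show False using f[of m] f_le[of m] k by auto
      next
        case False
        then show False
          using ordered_offD[OF ord u, of k m] p km k p_ne ep exu by (auto split: if_splits)
      qed
    qed
    then show "fst p < fst (i, j)" using km by simp
    show "wall R\<^sub>0 p (i, j)"
      unfolding wall_def km by (intro exI[of _ f]) (use f f_le mono in auto)
  next
    show "Q' p = R\<^sub>0 p \<or> e \<le> Q' p \<and> snd p \<le> snd p\<^sub>0" for p
      using ch[of p] e le by (auto simp: Q'_def)
    show "psi_trail e Q' (i, j) p\<^sub>0"
    proof -
      from trail obtain f where f: "\<And>c. j \<le> c \<Longrightarrow> c < snd p\<^sub>0 \<Longrightarrow>
          Suc i < f c \<and> e < Q (f c - 1, Suc c) \<and>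
          ((f c, c) \<in> D \<longrightarrow> Q (f c, c) + 2 \<le> Q (f c - 1, Suc c))"
        and mono: "\<And>c c'. j \<le> c \<Longrightarrow> c \<le> c' \<Longrightarrow> c' < snd p\<^sub>0 \<Longrightarrow> f c \<le> f c'"
        unfolding psi_trail_def by auto
      show ?thesis
        unfolding psi_trail_def
      proof (intro exI[of _ f] conjI allI impI)
        fix c assume c: "snd (i, j) \<le> c" "c < snd p\<^sub>0"
        then have fc: "Suc i < f c" "e < Q (f c - 1, Suc c)"
          "(f c, c) \<in> D \<Longrightarrow> Q (f c, c) + 2 \<le> Q (f c - 1, Suc c)"
          and jc: "j \<le> c" using f[of c] by auto
        then show "fst (i, j) < f c" "e < Q' (f c - 1, Suc c)"
          by (auto simp: Q'_def)
        show "Q' (f c, c) + 2 \<le> Q' (f c - 1, Suc c)" if "(f c, c) \<in> D"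
          using fc that jc by (auto simp: Q'_def)
      qed (use mono in auto)
    qed
  qed (use u le unch in \<open>auto simp: Q'_def\<close>)
  show "phi_slide_cond D e (Q', (i, j))"
    using e h by (simp add: phi_slide_cond_def Q'_def)
  show "phi_slide_step D e (Q', (i, j)) = (Q, (Suc i, j))"
    using right h Qh by (auto simp: phi_slide_step_def Let_def Q'_def fun_eq_iff)
qed

lemma psi_inv_step:
  assumes R0: "R\<^sub>0 \<in> reverse_ssyts D" and p0: "p\<^sub>0 \<in> D" "R\<^sub>0 p\<^sub>0 = e"
    and inv: "psi_inv R\<^sub>0 p\<^sub>0 e s" and cond: "psi_slide_cond a D e s"
  shows "psi_inv R\<^sub>0 p\<^sub>0 e (psi_slide_step D e s) \<and> phi_slide_cond D e (psi_slide_step D e s) \<and>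
    phi_slide_step D e (psi_slide_step D e s) = s \<and>
    fst (snd (psi_slide_step D e s)) + snd (snd (psi_slide_step D e s)) < fst (snd s) + snd (snd s)"
proof -
  obtain Q i j where s: "s = (Q, (i, j))" by (cases s) auto
  have "(i, j) \<in> D" using inv unfolding s psi_inv_def by simp
  then obtain i' j' where ij: "i = Suc i'" "j = Suc j'"
    using index_pos[of i j] by (cases i; cases j) auto
  show ?thesis
  proof (cases "(i, j') \<in> D \<and> ((i', j) \<in> D \<longrightarrow> Q (i, j') + 1 < Q (i', j))")
    case True
    then have "psi_slide_step D e s = (Q((i, j) := Q (i, j') + 1, (i, j') := e), (i, j'))"
      unfolding s psi_slide_step_def using ij by (auto simp: Let_def)
    then show ?thesis
      using psi_inv_left[OF R0 p0 inv[unfolded s ij], folded ij] True s ij by auto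
  next
    case False
    then have u: "(i', j) \<in> D" "(i, j') \<in> D \<Longrightarrow> Q (i', j) \<le> Q (i, j') + 1"
      using cond ij unfolding s psi_slide_cond_def by auto
    then have "psi_slide_step D e s = (Q((i, j) := Q (i', j) - 1, (i', j) := e), (i', j))"
      unfolding s psi_slide_step_def using ij by (auto simp: Let_def)
    \<comment> \<open>If the loop goes on because of the left entry \<open>x\<close>, then the upper
      entry is at most \<open>x + 1 \<le> e + a + content (i, j)\<close>.\<close>
    moreover have "Q (i', j) \<le> e + a + content (i, j)"
      using cond u ij unfolding s psi_slide_cond_def by auto
    ultimately show ?thesis
      using psi_inv_up[OF R0 p0 inv[unfolded s ij], folded ij] u s ij by auto
  qed
qed

text \<open>The coordinate sum of the hole decreases, and the moves are undone by those of
  \<open>\<Phi>\<close>, which halts at \<open>p\<close> because \<open>R\<close> is a tableau with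
  entry \<open>e\<close> there. The raised entry gives the end cell excess exactly
  \<open>e\<close>.\<close>

lemma psi_slide_correct:
  assumes R: "R \<in> reverse_ssyts D" and p: "p \<in> D" "R p = e"
    and ex: "\<And>q. q \<in> D \<Longrightarrow> excess R q \<le> e"
    and walls: "\<And>q. q \<in> D \<Longrightarrow> excess R q = e \<Longrightarrow> wall R q p"
  obtains Q h where "psi_slide a D e R p = Some (Q, h)"
    "phi_slide D e (Q(h := e + (a + content h))) h = Some (R, p)"
    "psi_inv R p e (Q, h)" "Q(h := e + (a + content h)) \<in> reverse_ssyts D"
proof -
  obtain i j where ij: "p = (i, j)" by (cases p)
  have e: "0 \<le> e" using R p unfolding reverse_ssyts_def tabloids_def by auto
  define s where "s = (R, p)"
  have inv: "psi_inv R p e s"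
    unfolding psi_inv_def s_def prod.case
  proof (intro conjI allI ballI impI)
    show "ordered_off p R" using rssyt_ordered_off[OF R, of p "R p"] by simp
    show "R \<in> tabloids D" using R unfolding reverse_ssyts_def by simp
    show "psi_trail e R p p" unfolding psi_trail_def by auto
    show "excess R q \<le> e" if "q \<in> D - {p}" for q using ex[of q] that by simp
    fix q assume q: "q \<in> D - {p}" "excess R q = e"
    show wall: "wall R q p" using walls q by simp
    obtain k l where kl: "q = (k, l)" by (cases q)
    have Rq: "e < R q" using weight_pos[of q] q by (simp add: excess_def)
    \<comment> \<open>The entry of \<open>q\<close> exceeds \<open>e\<close> as weights are
      positive, so \<open>q\<close> is not weakly below and right of \<open>p\<close>. If
      \<open>q\<close> is left of \<open>p\<close>, then the first step of the wall lies below
      \<open>q\<close> and not below \<open>p\<close>.\<close>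
    show "fst q < fst p"
    proof (rule ccontr)
      assume "\<not> fst q < fst p"
      then have "i \<le> k" using ij kl by simp
      then show False
        using wall rssyt_leD[OF R, of i j k l] Rq p q unfolding ij kl wall_def
        by (cases "j \<le> l") auto
    qed
  qed (use p in auto)
  let ?b = "psi_slide_cond a D e" and ?c = "psi_slide_step D e"
  note step = psi_inv_step[OF R p]
  obtain t where t: "while_option ?b ?c s = Some t"
  proof -
    have "\<exists>t. while_option ?b ?c s = Some t"
    proof (rule measure_while_option_Some[where P = "psi_inv R p e"
          and f = "\<lambda>s. fst (snd s) + snd (snd s)"])
      show "psi_inv R p e (?c s) \<and> fst (snd (?c s)) + snd (snd (?c s)) < fst (snd s) + snd (snd s)"
        if "psi_inv R p e s" "?b s" for s using step[OF that] by simp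
    qed (fact inv)
    then show ?thesis using that by blast
  qed
  obtain Q h where t': "t = (Q, h)" by (cases t)
  have inv': "psi_inv R p e (Q, h)"
    using while_option_rule[OF _ t, of "psi_inv R p e"] step inv t' by blast
  have stop: "\<not> ?b (Q, h)" using while_option_stop[OF t] t' by simp
  have stop': "\<not> phi_slide_cond D e s"
    using rssyt_leD[OF R, of i j i "Suc j"] rssyt_leD[OF R, of i j "Suc i" j] p
    unfolding s_def phi_slide_cond_def ij by auto
  have reverse: "while_option (phi_slide_cond D e) (phi_slide_step D e) t = Some s"
    by (rule while_option_reverse[where P = "psi_inv R p e", OF t inv]) (simp_all add: step stop')
  have h: "h \<in> D" "Q \<in> tabloids D" "ordered_off h Q" "Q h = e"
      "\<And>q. q \<in> D - {h} \<Longrightarrow> excess Q q \<le> e"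
      "\<And>q. q \<in> D - {h} \<Longrightarrow> excess Q q = e \<Longrightarrow> fst q < fst h"
    by (insert inv'[unfolded psi_inv_def prod.case], blast)+
  obtain i' j' where h': "h = (i', j')" by (cases h)
  let ?R = "Q(h := e + (a + content h))"
  have "?R \<in> reverse_ssyts D"
  proof (rule rssyt_fill_hole[OF _ h(3)[unfolded h']])
    show "?R \<in> tabloids D"
      using h(1,2) e weight_pos[OF h(1)] unfolding tabloids_def by auto
    \<comment> \<open>Cells of excess \<open>e\<close> are strictly above \<open>h\<close>, so the
      right neighbour has excess below \<open>e\<close>; mere \<open>\<le>\<close> would leave its
      entry possibly one too large.\<close>
    show "?R (i', Suc j') \<le> ?R (i', j')" if "(i', Suc j') \<in> D"
      using h(5,6)[of "(i', Suc j')"] that h' by (force simp: excess_pair content_def)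
    show "?R (Suc i', j') < ?R (i', j')" if "(Suc i', j') \<in> D"
      using h(5,6)[of "(Suc i', j')"] that h' by (force simp: excess_pair content_def)
    show "?R (i', j') \<le> ?R (i', l)" if "(i', l) \<in> D" "Suc l = j'" for l
      using stop that h' by (auto simp: psi_slide_cond_def)
    show "?R (i', j') < ?R (k, j')" if "(k, j') \<in> D" "Suc k = i'" for k
      using stop that h' by (auto simp: psi_slide_cond_def)
  qed (use h' in auto)
  then show ?thesis
    using that[of Q h] t t' inv' reverse h(4) unfolding phi_slide_def psi_slide_def s_def
    by (simp add: fun_upd_idem)
qed

section \<open>One round of \<open>\<Psi>\<close>\<close>

text \<open>The invariant supplies the walls that steer the slide. Afterwards no excess is greater
  than \<open>e\<close>, and all cells of excess \<open>e\<close> other than the end cell lie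
  strictly above it, so \<open>\<Phi>\<close> selects the end cell and slides back.\<close>

lemma psi_step:
  assumes R: "R \<in> reverse_ssyts D" and linked: "linked R T" and T: "\<exists>q\<in>D. T q \<noteq> 0"
    and e: "e = psi_min D R T"
  obtains p Q h where "psi_select D R T e = Some p" "p \<in> D" "T p \<noteq> 0"
    "psi_slide a D e R p = Some (Q, h)" "h \<in> D" "0 \<le> e" "Q h = e"
    "Q(h := e + (a + content h)) \<in> reverse_ssyts D"
    "linked (Q(h := e + (a + content h))) (T(p := T p - 1))"
    "phi_max a D (Q(h := e + (a + content h))) = e"
    "phi_select a D (Q(h := e + (a + content h))) e = Some h"
    "phi_slide D e (Q(h := e + (a + content h))) h = Some (R, p)"
proof -
  have min: "e \<le> R q" if "q \<in> D" "T q \<noteq> 0" for q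
    using that finite e by (auto simp: psi_min_def)
  let ?E = "{q \<in> D. T q \<noteq> 0 \<and> R q = e}"
  have E: "?E \<noteq> {}"
  proof -
    have "e \<in> R ` {q \<in> D. T q \<noteq> 0}"
      unfolding e psi_min_def by (rule Min_in) (use finite T in auto)
    then show ?thesis by auto
  qed
  have "finite ?E" using finite by simp
  from finite_ex_maximal[OF this E, of snd]
  obtain p where "p \<in> ?E" "\<forall>q\<in>?E. snd q \<le> snd p" by blast
  then have p: "p \<in> D" "T p \<noteq> 0" "R p = e"
    and rightmost: "\<And>q. q \<in> D \<Longrightarrow> T q \<noteq> 0 \<Longrightarrow> R q = e \<Longrightarrow> snd q \<le> snd p"
    by auto
  have e0: "0 \<le> e" using R p unfolding reverse_ssyts_def tabloids_def by auto
  have ex: "excess R q \<le> e" "excess R q = e \<Longrightarrow> wall R q p" if "q \<in> D" for q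
    using linked p that unfolding linked_def by auto
  obtain Q h where slide: "psi_slide a D e R p = Some (Q, h)"
    "phi_slide D e (Q(h := e + (a + content h))) h = Some (R, p)"
    and inv: "psi_inv R p e (Q, h)" and R': "Q(h := e + (a + content h)) \<in> reverse_ssyts D"
    using psi_slide_correct[OF R p(1,3) ex] by metis
  define R' where "R' = Q(h := e + (a + content h))"
  have h: "h \<in> D" "Q h = e"
    and exQ: "\<And>q. q \<in> D - {h} \<Longrightarrow> excess Q q \<le> e"
      "\<And>q. q \<in> D - {h} \<Longrightarrow> excess Q q = e \<Longrightarrow> fst q < fst h"
    and ch: "\<And>q. Q q = R q \<or> e \<le> Q q \<and> snd q \<le> snd p"
    and trail: "psi_trail e Q h p"
    by (insert inv[unfolded psi_inv_def prod.case], blast)+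
  have R'h: "e < R' h" using weight_pos[OF h(1)] by (simp add: R'_def)
  have exh: "excess R' h = e" by (simp add: R'_def excess_def)
  have ex': "excess R' q \<le> e" "excess R' q = e \<Longrightarrow> q = h \<or> fst q < fst h" if "q \<in> D" for q
    using exQ[of q] exh that by (cases "q = h"; simp add: R'_def excess_def)+
  let ?T = "T(p := T p - 1)"
  \<comment> \<open>Unchanged marked entries obey the minimal and rightmost choice of
    \<open>p\<close>; changed ones are at least \<open>e\<close> and lie in columns up to that of
    \<open>p\<close>.\<close>
  have marked: "e \<le> R' q" "R' q = e \<Longrightarrow> snd q \<le> snd p" if "q \<in> D" "?T q \<noteq> 0" for q
  proof -
    have Tq: "T q \<noteq> 0" using that p by (auto split: if_splits)
    show "e \<le> R' q" "R' q = e \<Longrightarrow> snd q \<le> snd p"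
      using ch[of q] min[OF that(1) Tq] rightmost[OF that(1) Tq] R'h
      by (cases "q = h"; auto simp: R'_def)+
  qed
  have "linked R' ?T"
    unfolding linked_def
  proof (intro ballI impI conjI)
    fix q r assume q: "q \<in> D" "?T q \<noteq> 0" and r: "r \<in> D"
    show "excess R' r \<le> R' q" using ex'(1)[OF r] marked(1)[OF q] by simp
    assume "excess R' r = R' q"
    then have eq: "excess R' r = e" "R' q = e" using ex'(1)[OF r] marked(1)[OF q] by auto
    then have r_above: "fst r \<le> fst h" using ex'(2)[OF r] by auto
    \<comment> \<open>Being weakly above \<open>h\<close> and strictly left of it would give
      \<open>r\<close> a greater excess than \<open>h\<close>.\<close>
    have r_right: "snd h \<le> snd r"
      using rssyt_excess[OF R'[folded R'_def], of "fst r" "snd r" "fst h" "snd h"] r h(1) r_above eq exh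
      by (cases "snd h \<le> snd r") auto
    have q_left: "snd q \<le> snd p" using marked(2)[OF q] eq by simp
    from trail obtain f where f: "\<And>c. snd h \<le> c \<Longrightarrow> c < snd p \<Longrightarrow>
        fst h < f c \<and> e < Q (f c - 1, Suc c) \<and>
        ((f c, c) \<in> D \<longrightarrow> Q (f c, c) + 2 \<le> Q (f c - 1, Suc c))"
      and mono: "\<And>c c'. snd h \<le> c \<Longrightarrow> c \<le> c' \<Longrightarrow> c' < snd p \<Longrightarrow> f c \<le> f c'"
      unfolding psi_trail_def by blast
    have f_le: "f c \<le> fst q" if c: "snd r \<le> c" "c < snd q" for c
    proof -
      obtain m where m: "snd q = Suc m" "c \<le> m" using c by (cases "snd q") auto
      have m': "snd h \<le> m" "m < snd p" using m c r_right q_left by auto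
      \<comment> \<open>Column \<open>m\<close> is the last one before \<open>q\<close>. If the
        staircase were below \<open>q\<close> there, the cell \<open>(f m - 1, Suc m)\<close> would
        be weakly below \<open>q\<close> in its column and yet have an entry above \<open>e\<close>.
        Outside the shape the entry is 0, which is not above \<open>e\<close> either.\<close>
      have "f m \<le> fst q"
      proof (rule ccontr)
        assume less: "\<not> f m \<le> fst q"
        have "Suc m \<noteq> snd h" using m' by simp
        then have *: "e < R' (f m - 1, Suc m)" using f[OF m'] by (auto simp: R'_def)
        show False
        proof (cases "(f m - 1, Suc m) \<in> D")
          case True
          moreover obtain k where "q = (k, Suc m)" using m(1) by (cases q) auto
          moreover from this have "k \<le> f m - 1" using less by simp
          ultimately show False
            using rssyt_leD[OF R'[folded R'_def], of k "Suc m" "f m - 1" "Suc m"] q less eq *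
            by auto
        next
          case False
          then have "R' (f m - 1, Suc m) = 0"
            using R' unfolding R'_def reverse_ssyts_def tabloids_def by blast
          then show False using * e0 by simp
        qed
      qed
      then show ?thesis using mono[of c m] c m m' r_right by auto
    qed
    show "wall R' r q"
      unfolding wall_def
    proof (intro exI[of _ f] conjI allI impI)
      fix c assume c: "snd r \<le> c" "c < snd q"
      then have c': "snd h \<le> c" "c < snd p" using r_right q_left by auto
      show *: "fst r < f c" "f c \<le> fst q" using f[OF c'] r_above f_le[OF c] by auto
      have "(f c, c) \<in> D"
        using convex[of "fst r" "snd r" "fst q" "snd q" "f c" c] r q c * by auto
      then show "R' (f c, c) + 2 \<le> R' (f c - 1, Suc c)"
        using f[OF c'] c' by (cases h) (auto simp: R'_def)
    qed (use mono r_right q_left in auto)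
  qed
  moreover have "phi_max a D R' = e"
    unfolding phi_max_excess
  proof (rule Max_eqI)
    show "e \<in> excess R' ` D" using h(1) exh by (metis imageI)
  qed (use finite ex' in auto)
  moreover have "phi_select a D R' e = Some h"
    unfolding phi_select_def
  proof (rule the_onlyI)
    show "h \<in> D \<and> R' h - (a + content h) = e \<and>
        (\<forall>q\<in>D. R' q - (a + content q) = e \<longrightarrow> fst q \<le> fst h)"
      using h(1) exh ex'(2) by (force simp: excess_def)
    show "q = h" if "q \<in> D \<and> R' q - (a + content q) = e \<and>
        (\<forall>q'\<in>D. R' q' - (a + content q') = e \<longrightarrow> fst q' \<le> fst q)" for q
      using that h(1) exh ex'(2)[of q] by (force simp: excess_def)
  qed
  moreover have "psi_select D R T e = Some p"
    unfolding psi_select_def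
  proof (rule the_onlyI)
    show "p \<in> D \<and> R p = e \<and> T p \<noteq> 0 \<and> (\<forall>q\<in>D. R q = e \<and> T q \<noteq> 0 \<longrightarrow> snd q \<le> snd p)"
      using p rightmost by blast
    fix q assume "q \<in> D \<and> R q = e \<and> T q \<noteq> 0 \<and> (\<forall>q'\<in>D. R q' = e \<and> T q' \<noteq> 0 \<longrightarrow> snd q' \<le> snd q)"
    then have q: "q \<in> D" "R q = e" "snd q = snd p" using p rightmost by (blast intro: le_antisym)+
    then show "q = p"
      using rssyt_leD[OF R, of "fst p" "snd p" "fst q" "snd p"] p
        rssyt_leD[OF R, of "fst q" "snd p" "fst p" "snd p"]
      by (cases p, cases q, cases "fst p" "fst q" rule: linorder_cases) auto
  qed
  ultimately show ?thesis
    using that slide R' h e0 p unfolding R'_def by blast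
qed

end

section \<open>Skew diagrams of partitions and the bound on the entries\<close>

lemma part_antimono:
  assumes "is_partition l" "1 \<le> i" "i \<le> k"
  shows "part l k \<le> part l i"
proof (cases "i < k \<and> k \<le> length l")
  case True
  then show ?thesis
    using assms sorted_wrt_nth_less[of "(\<ge>)" l "i - 1" "k - 1"]
    unfolding is_partition_def part_def by auto
qed (use assms in \<open>auto simp: part_def\<close>)

lemma mem_skew_iff:
  "(i, j) \<in> skew lam mu \<longleftrightarrow> 1 \<le> i \<and> i \<le> length lam \<and> part mu i < j \<and> j \<le> part lam i"
  unfolding skew_def diagram_def part_def by auto

locale skew_partition =
  fixes lam mu :: "nat list" and a :: int
  assumes lam: "is_partition lam" and mu: "is_partition mu"
    and weight_pos: "\<rho> \<in> skew lam mu \<Longrightarrow> a + content \<rho> > 0"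
begin

abbreviation S :: "cell set" where "S \<equiv> skew lam mu"

sublocale skew_shape S a
proof
  have "S \<subseteq> Sigma {..length lam} (\<lambda>i. {..part lam i})"
    by (auto simp: mem_skew_iff)
  then show "finite S" by (rule finite_subset) simp
  show "(k, l) \<in> S"
    if "(i, j) \<in> S" "(i', j') \<in> S" "i \<le> k" "k \<le> i'" "j \<le> l" "l \<le> j'" for i j i' j' k l
    using that part_antimono[OF lam, of k i'] part_antimono[OF mu, of i k]
    by (auto simp: mem_skew_iff)
  show "0 < i \<and> 0 < j" if "(i, j) \<in> S" for i j
    using that by (auto simp: mem_skew_iff)
qed (fact weight_pos)

text \<open>The first cell of row \<open>i\<close> has column \<open>part mu i + 1\<close> and the
  largest entry of the row. Its weight is one more than the bound \<open>a + part mu i - i\<close>,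
  so there exceeding the bound means nonnegative excess. Every other cell of the row has at least
  this weight.\<close>

lemma unbounded_iff_excess:
  assumes R: "R \<in> reverse_ssyts S"
  shows "(\<exists>(i, j)\<in>S. R (i, j) > a + int (part mu i) - int i) \<longleftrightarrow> (\<exists>p\<in>S. 0 \<le> excess R p)"
proof
  assume "\<exists>(i, j)\<in>S. R (i, j) > a + int (part mu i) - int i"
  then obtain i j where ij: "(i, j) \<in> S" "R (i, j) > a + int (part mu i) - int i" by auto
  let ?p = "(i, Suc (part mu i))"
  have "?p \<in> S" using ij by (auto simp: mem_skew_iff)
  moreover have "R (i, j) \<le> R ?p"
    using rssyt_leD[OF R \<open>?p \<in> S\<close> ij(1)] ij(1) by (auto simp: mem_skew_iff)
  ultimately show "\<exists>p\<in>S. 0 \<le> excess R p"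
    using ij by (intro bexI[of _ ?p]) (auto simp: excess_pair)
next
  assume "\<exists>p\<in>S. 0 \<le> excess R p"
  then obtain i j where ij: "(i, j) \<in> S" "0 \<le> excess R (i, j)" by auto
  then show "\<exists>(i, j)\<in>S. R (i, j) > a + int (part mu i) - int i"
    by (intro bexI[of _ "(i, j)"]) (auto simp: excess_pair mem_skew_iff)
qed

lemma bounded_iff_excess:
  "R \<in> bounded_reverse_ssyts a lam mu \<longleftrightarrow> R \<in> reverse_ssyts S \<and> (\<forall>p\<in>S. excess R p < 0)"
proof -
  have "R \<in> bounded_reverse_ssyts a lam mu \<longleftrightarrow>
      R \<in> reverse_ssyts S \<and> \<not> (\<exists>(i, j)\<in>S. R (i, j) > a + int (part mu i) - int i)"
    unfolding bounded_reverse_ssyts_def by (simp add: split_beta not_less)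
  also have "\<dots> \<longleftrightarrow> R \<in> reverse_ssyts S \<and> \<not> (\<exists>p\<in>S. 0 \<le> excess R p)"
    using unbounded_iff_excess[of R] by blast
  finally show ?thesis by (simp add: not_le)
qed

section \<open>Iterating the rounds\<close>

lemma phi_loop_bounded:
  assumes "R \<in> bounded_reverse_ssyts a lam mu"
  shows "phi_loop a lam mu R T = Some (R, T)"
proof -
  have "\<not> (\<exists>(i, j)\<in>S. R (i, j) > a + int (part mu i) - int i)"
    using assms unfolding bounded_reverse_ssyts_def by fastforce
  then show ?thesis by (subst phi_loop.simps) simp
qed

lemma phi_loop_step:
  assumes "R \<in> reverse_ssyts S" "\<exists>p\<in>S. 0 \<le> excess R p"
    and "phi_select a S R (phi_max a S R) = Some p"
    and "phi_slide S (phi_max a S R) R p = Some (R', h)"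
  shows "phi_loop a lam mu R T = phi_loop a lam mu R' (T(h := T h + 1))"
  using assms unbounded_iff_excess[OF assms(1)]
  by (subst phi_loop.simps) (simp add: Let_def)

lemma psi_loop_step:
  assumes "\<exists>q\<in>S. T q \<noteq> 0"
    and "psi_select S R T (psi_min S R T) = Some p"
    and "psi_slide a S (psi_min S R T) R p = Some (Q, h)"
  shows "psi_loop a lam mu R T =
    psi_loop a lam mu (Q(h := Q h + (a + content h))) (T(p := T p - 1))"
  using assms by (subst psi_loop.simps) (simp add: Let_def)

lemma psi_loop_zero: "psi_loop a lam mu Q (\<lambda>_. 0) = Some Q"
  by (subst psi_loop.simps) simp

lemma linked_zero: "linked R (\<lambda>_. 0)"
  by (simp add: linked_def)

lemma linked_bounded:
  assumes "R \<in> bounded_reverse_ssyts a lam mu"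
  shows "linked R T"
proof -
  have "excess R p < R q" if "p \<in> S" "q \<in> S" for p q
  proof -
    have "excess R p < 0" using assms that(1) by (simp add: bounded_iff_excess)
    moreover have "0 \<le> R q"
      using assms that(2) by (simp add: bounded_iff_excess reverse_ssyts_def tabloids_def)
    ultimately show ?thesis by simp
  qed
  then show ?thesis unfolding linked_def by (metis less_imp_le less_irrefl)
qed

text \<open>Induction on the norm, which drops by a positive weight in every round. Inversion is
  phrased as equality of two \<open>\<Psi>\<close>-runs, which composes over rounds for arbitrary
  \<open>T\<close>; with \<open>T = 0\<close> the run on the right halts at once.\<close>

lemma phi_loop_correct:
  assumes "R \<in> reverse_ssyts S" "T \<in> tabloids S" "linked R T"
  shows "\<exists>R' T'. phi_loop a lam mu R T = Some (R', T') \<and>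
    R' \<in> bounded_reverse_ssyts a lam mu \<and> T' \<in> tabloids S \<and>
    psi_loop a lam mu R' T' = psi_loop a lam mu R T \<and>
    norm_of S R' + content_weight a S T' = norm_of S R + content_weight a S T"
  using assms
proof (induction "nat (norm_of S R)" arbitrary: R T rule: less_induct)
  case less
  show ?case
  proof (cases "\<exists>p\<in>S. 0 \<le> excess R p")
    case False
    then have "R \<in> bounded_reverse_ssyts a lam mu"
      using less.prems by (auto simp: bounded_iff_excess)
    then show ?thesis using phi_loop_bounded[of R T] less.prems by auto
  next
    case True
    define e where "e = phi_max a S R"
    have e0: "0 \<le> e"
      using True finite Max_ge[of "excess R ` S"] unfolding e_def phi_max_excess
      by (metis finite_imageI image_eqI order_trans)
    have ne: "S \<noteq> {}" using True by auto
    obtain p R' h where *: "phi_select a S R e = Some p" "phi_slide S e R p = Some (R', h)"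
      "R' \<in> reverse_ssyts S" "h \<in> S" "linked R' (T(h := T h + 1))"
      "sum R' S + (a + content h) = sum R S"
      "psi_min S R' (T(h := T h + 1)) = e" "psi_select S R' (T(h := T h + 1)) e = Some h"
      "psi_slide a S e R' h = Some (R(p := e), p)" "R p = e + (a + content p)"
      by (rule phi_step[OF less.prems(1,3,2) ne e_def e0])
    let ?T = "T(h := T h + 1)"
    have T: "?T \<in> tabloids S" "?T h \<noteq> 0" using less.prems(2) *(4) by (auto simp: tabloids_def)
    have "0 \<le> sum R' S"
      using *(3) by (intro sum_nonneg) (auto simp: reverse_ssyts_def tabloids_def)
    then have "nat (norm_of S R') < nat (norm_of S R)"
      using *(6) weight_pos[OF *(4)] by (simp add: norm_of_def)
    from less.hyps[OF this *(3) T(1) *(5)]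
    obtain R'' T'' where IH: "phi_loop a lam mu R' ?T = Some (R'', T'')"
      "R'' \<in> bounded_reverse_ssyts a lam mu" "T'' \<in> tabloids S"
      "psi_loop a lam mu R'' T'' = psi_loop a lam mu R' ?T"
      "norm_of S R'' + content_weight a S T'' = norm_of S R' + content_weight a S ?T" by auto
    have "phi_loop a lam mu R T = phi_loop a lam mu R' ?T"
      by (rule phi_loop_step[OF less.prems(1) True *(1,2)[unfolded e_def]])
    moreover have "psi_loop a lam mu R' ?T = psi_loop a lam mu R T"
    proof -
      have "\<exists>q\<in>S. ?T q \<noteq> 0" using T *(4) by blast
      \<comment> \<open>Adding the weight in cell \<open>p\<close> turns \<open>R(p := e)\<close>
        into \<open>R\<close> again, and lowering the mark at \<open>h\<close> restores
        \<open>T\<close>.\<close>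
      from psi_loop_step[where R = R' and p = h and Q = "R(p := e)" and h = p, OF this] *(7-10)
      show ?thesis by (simp del: fun_upd_apply) (simp add: fun_upd_idem)
    qed
    \<comment> \<open>The norm loses \<open>a + content h\<close>, and the new mark at
      \<open>h\<close> adds the same amount to the content weight.\<close>
    moreover have "norm_of S R' + content_weight a S ?T = norm_of S R + content_weight a S T"
      using *(6) sum.remove[OF finite *(4), of "\<lambda>q. T q * (a + content q)"]
        sum.remove[OF finite *(4), of "\<lambda>q. ?T q * (a + content q)"]
      by (simp add: norm_of_def content_weight_def algebra_simps)
    ultimately show ?thesis using IH by auto
  qed
qed

text \<open>Induction on the number of marks, counted with multiplicity. The equality of
  \<open>\<Phi>\<close>-runs is again the form that composes over rounds.\<close>

lemma psi_loop_correct: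
  assumes "R \<in> reverse_ssyts S" "T \<in> tabloids S" "linked R T"
  shows "\<exists>Q\<in>reverse_ssyts S. psi_loop a lam mu R T = Some Q \<and>
    phi_loop a lam mu Q (\<lambda>_. 0) = phi_loop a lam mu R T"
  using assms
proof (induction "nat (sum T S)" arbitrary: R T rule: less_induct)
  case less
  show ?case
  proof (cases "\<exists>q\<in>S. T q \<noteq> 0")
    case False
    have "T = (\<lambda>_. 0)"
    proof
      show "T q = 0" for q
        using False less.prems(2) by (cases q, cases "q \<in> S") (auto simp: tabloids_def)
    qed
    then show ?thesis using psi_loop_zero less.prems(1) by auto
  next
    case True
    define e where "e = psi_min S R T"
    obtain p Q h where *: "psi_select S R T e = Some p" "p \<in> S" "T p \<noteq> 0"
      "psi_slide a S e R p = Some (Q, h)" "h \<in> S" "0 \<le> e" "Q h = e"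
      "Q(h := e + (a + content h)) \<in> reverse_ssyts S"
      "linked (Q(h := e + (a + content h))) (T(p := T p - 1))"
      "phi_max a S (Q(h := e + (a + content h))) = e"
      "phi_select a S (Q(h := e + (a + content h))) e = Some h"
      "phi_slide S e (Q(h := e + (a + content h))) h = Some (R, p)"
      by (rule psi_step[OF less.prems(1,3) True e_def])
    let ?T = "T(p := T p - 1)" and ?R = "Q(h := e + (a + content h))"
    have T: "?T \<in> tabloids S" "0 < T p"
      using less.prems(2) *(2,3) by (force simp: tabloids_def order_le_less)+
    have "sum ?T S < sum T S"
      using sum.remove[OF finite *(2), of T] sum.remove[OF finite *(2), of ?T] by simp
    moreover have "0 \<le> sum ?T S" using T(1) by (intro sum_nonneg) (auto simp: tabloids_def)
    ultimately have "nat (sum ?T S) < nat (sum T S)" by simp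
    from less.hyps[OF this *(8) T(1) *(9)]
    obtain Q' where IH: "Q' \<in> reverse_ssyts S" "psi_loop a lam mu ?R ?T = Some Q'"
      "phi_loop a lam mu Q' (\<lambda>_. 0) = phi_loop a lam mu ?R ?T" by blast
    have "psi_loop a lam mu R T = psi_loop a lam mu ?R ?T"
      using psi_loop_step[OF True *(1,4)[unfolded e_def]] *(7) by (simp add: e_def)
    moreover have "phi_loop a lam mu ?R ?T = phi_loop a lam mu R T"
    proof -
      have "\<exists>q\<in>S. 0 \<le> excess ?R q"
        using *(5,6) by (intro bexI[of _ h]) (auto simp: excess_def)
      from phi_loop_step[OF *(8) this, of h R p ?T] *(10-12) show ?thesis by simp
    qed
    ultimately show ?thesis using IH by auto
  qed
qed

end

theorem theorem2p2:
  fixes lam mu :: "nat list" and a :: int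
  assumes "is_partition lam" and "is_partition mu" and "partition_contained mu lam"
    and "\<forall>\<rho>\<in>skew lam mu. a + content \<rho> > 0"
  shows
    "(\<forall>Q\<in>reverse_ssyts (skew lam mu).
        \<exists>P\<in>bounded_reverse_ssyts a lam mu \<times> tabloids (skew lam mu). Phi a lam mu Q = Some P) \<and>
     (\<forall>P\<in>bounded_reverse_ssyts a lam mu \<times> tabloids (skew lam mu).
        \<exists>Q\<in>reverse_ssyts (skew lam mu). Psi a lam mu P = Some Q) \<and>
     (\<forall>Q\<in>reverse_ssyts (skew lam mu). Option.bind (Phi a lam mu Q) (Psi a lam mu) = Some Q) \<and>
     (\<forall>P\<in>bounded_reverse_ssyts a lam mu \<times> tabloids (skew lam mu).
        Option.bind (Psi a lam mu P) (Phi a lam mu) = Some P) \<and>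
     (\<forall>Q\<in>reverse_ssyts (skew lam mu). \<forall>R T. Phi a lam mu Q = Some (R, T) \<longrightarrow>
        norm_of (skew lam mu) Q = norm_of (skew lam mu) R + content_weight a (skew lam mu) T)"
proof -
  interpret skew_partition lam mu a
    using assms by unfold_locales auto
  have zero: "(\<lambda>_. 0) \<in> tabloids S" by (simp add: tabloids_def)
  have phi: "\<exists>R T. Phi a lam mu Q = Some (R, T) \<and> R \<in> bounded_reverse_ssyts a lam mu \<and>
      T \<in> tabloids S \<and> Psi a lam mu (R, T) = Some Q \<and>
      norm_of S Q = norm_of S R + content_weight a S T" if "Q \<in> reverse_ssyts S" for Q
    using phi_loop_correct[OF that zero linked_zero]
    by (auto simp: Phi_def Psi_def psi_loop_zero content_weight_def)
  \<comment> \<open>For bounded \<open>R\<close> the \<open>\<Phi>\<close>-loop started at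
    \<open>(R, T)\<close> halts immediately, so the equality of runs shows that
    \<open>\<Phi>\<close> returns \<open>(R, T)\<close>.\<close>
  have psi: "\<exists>Q\<in>reverse_ssyts S. Psi a lam mu (R, T) = Some Q \<and> Phi a lam mu Q = Some (R, T)"
    if "R \<in> bounded_reverse_ssyts a lam mu" "T \<in> tabloids S" for R T
    using psi_loop_correct[OF _ that(2) linked_bounded[OF that(1)]] phi_loop_bounded[OF that(1), of T] that(1)
    by (auto simp: Phi_def Psi_def bounded_iff_excess)
  show ?thesis
  proof (intro conjI ballI allI impI)
    fix Q assume "Q \<in> reverse_ssyts S"
    from phi[OF this] show "\<exists>P\<in>bounded_reverse_ssyts a lam mu \<times> tabloids S. Phi a lam mu Q = Some P"
      "Option.bind (Phi a lam mu Q) (Psi a lam mu) = Some Q" by auto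
    fix R T assume "Phi a lam mu Q = Some (R, T)"
    with phi[OF \<open>Q \<in> reverse_ssyts S\<close>]
    show "norm_of S Q = norm_of S R + content_weight a S T" by auto
  next
    fix P assume "P \<in> bounded_reverse_ssyts a lam mu \<times> tabloids S"
    then obtain R T where "P = (R, T)" "R \<in> bounded_reverse_ssyts a lam mu" "T \<in> tabloids S" by auto
    with psi show "\<exists>Q\<in>reverse_ssyts S. Psi a lam mu P = Some Q"
      "Option.bind (Psi a lam mu P) (Phi a lam mu) = Some P" by fastforce+
  qed
qed

end
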